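(* There is a constant $C>0$ such that for all positive integers $n$ and $\ell$ the polytope $\mathrm{P}_{\mathrm{cycl}}^{\ell}(n)$ has an extension of size at most $2^{C\ell}\,n^3\log n$ for which, moreover, the encoding lengths of the coefficients needed to describe it (i.e., of the coefficients of a system of linear equations and inequalities defining the extension polyhedron and of the projection) are bounded by $C$.
   Context: $K_n=([n],E_n)$ is the complete graph on $[n]=\{1,\dots,n\}$. $\mathcal{C}^{\ell}(n)$ is the set of all (edge sets of) simple cycles $C\subseteq E_n$ of length $|C|=\ell$ in $K_n$; $\chi(C)\in\{0,1\}^{E_n}$ is the characteristic vector of $C$; and $\mathrm{P}_{\mathrm{cycl}}^{\ell}(n)=\operatorname{conv}\{\chi(C): C\in\mathcal{C}^{\ell}(n)\}\subseteq\mathbb{R}^{E_n}$ (empty if $\ell<3$ or $\ell>n$). An extension of a polytope $P\subseteq\mathbb{R}^m$ is a polyhedron $Q\subseteq\mathbb{R}^d$ together with an affine map $p:\mathbb{R}^d\to\mathbb{R}^m$ with $p(Q)=P$. The size of the extension is the number of facets of $Q$. No symmetry is required of the extension. *)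

theory Defs
  imports "HOL-Analysis.Analysis" "HOL-Analysis.Finite_Function_Topology"
begin

text \<open>
  The dimensions below depend on variables that are quantified inside the formula, so they
  cannot be types. A coordinate space with finite index set \<open>I\<close> is rendered as the subspace
  of all \<open>x\<close> in \<open>'i \<Rightarrow>\<^sub>0 real\<close> (a real vector space in the library) whose support
  \<open>Poly_Mapping.keys x\<close> lies in \<open>I\<close>. For the \<open>d\<close>-dimensional space take \<open>I = {..<d}\<close>; for
  the space of a cycle polytope take the edge set of the complete graph.
\<close>

definition complete_edges :: "nat \<Rightarrow> nat set set" where
  "complete_edges n = {e. e \<subseteq> {1..n} \<and> card e = 2}"

definition simple_cycles :: "nat \<Rightarrow> nat \<Rightarrow> nat set set set" where
  "simple_cycles n l =
     {C. 3 \<le> l \<and> (\<exists>vs. distinct vs \<and> set vs \<subseteq> {1..n} \<and> length vs = l \<and>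
           C = {{vs ! i, vs ! (Suc i mod l)} | i. i < l})}"

definition char_vec :: "'e set \<Rightarrow> 'e \<Rightarrow>\<^sub>0 real" where
  "char_vec C = (\<Sum>e\<in>C. Poly_Mapping.single e 1)"

definition cycle_polytope :: "nat \<Rightarrow> nat \<Rightarrow> (nat set \<Rightarrow>\<^sub>0 real) set" where
  "cycle_polytope n l = convex hull (char_vec ` simple_cycles n l)"

definition linear_form :: "nat \<Rightarrow> (nat \<Rightarrow> rat) \<Rightarrow> (nat \<Rightarrow>\<^sub>0 real) \<Rightarrow> real" where
  "linear_form d a y = (\<Sum>j<d. of_rat (a j) * Poly_Mapping.lookup y j)"

text \<open>
  The polyhedron in dimension \<open>d\<close> given by the \<open>m\<close> inequalities \<open>A y \<le> b\<close> and the \<open>k\<close>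
  equations \<open>B y = c\<close>.
\<close>

definition rat_polyhedron ::
  "nat \<Rightarrow> nat \<Rightarrow> (nat \<Rightarrow> nat \<Rightarrow> rat) \<Rightarrow> (nat \<Rightarrow> rat) \<Rightarrow>
   nat \<Rightarrow> (nat \<Rightarrow> nat \<Rightarrow> rat) \<Rightarrow> (nat \<Rightarrow> rat) \<Rightarrow> (nat \<Rightarrow>\<^sub>0 real) set" where
  "rat_polyhedron d m A b k B c =
     {y. Poly_Mapping.keys y \<subseteq> {..<d} \<and>
         (\<forall>i<m. linear_form d (A i) y \<le> of_rat (b i)) \<and>
         (\<forall>i<k. linear_form d (B i) y = of_rat (c i))}"

text \<open>The affine map \<open>y \<mapsto> T y + t\<close> from dimension \<open>d\<close> into the coordinate space of \<open>E\<close>.\<close>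

definition rat_affine_map ::
  "'e set \<Rightarrow> nat \<Rightarrow> ('e \<Rightarrow> nat \<Rightarrow> rat) \<Rightarrow> ('e \<Rightarrow> rat) \<Rightarrow> (nat \<Rightarrow>\<^sub>0 real) \<Rightarrow> ('e \<Rightarrow>\<^sub>0 real)" where
  "rat_affine_map E d T t y =
     (\<Sum>e\<in>E. Poly_Mapping.single e (linear_form d (T e) y + of_rat (t e)))"

text \<open>
  The library's \<^const>\<open>aff_dim\<close> and \<^const>\<open>facet_of\<close> require the type class
  \<^class>\<open>euclidean_space\<close>, which finitely supported functions on an infinite type do not
  satisfy. The following two definitions are their counterparts for sets contained in a
  finite-dimensional subspace of a real vector space (with dimension \<open>-1\<close> for the empty set).
\<close>

definition affine_dimension :: "'a::real_vector set \<Rightarrow> int" where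
  "affine_dimension S = (if S = {} then -1 else int (dim {x - y | x y. x \<in> S \<and> y \<in> S}))"

definition facets :: "'a::real_vector set \<Rightarrow> 'a set set" where
  "facets Q = {F. F face_of Q \<and> F \<noteq> {} \<and> affine_dimension F = affine_dimension Q - 1}"

text \<open>
  Binary encoding length of a rational in lowest terms: one sign bit plus the lengths of
  numerator and denominator.
\<close>

definition encoding_length :: "rat \<Rightarrow> int" where
  "encoding_length r =
     (case quotient_of r of (p, q) \<Rightarrow>
        1 + \<lceil>log 2 (\<bar>real_of_int p\<bar> + 1)\<rceil> + \<lceil>log 2 (\<bar>real_of_int q\<bar> + 1)\<rceil>)"

end

theory Submission
  imports Defs
begin

text \<open>
  Colour coding. A family of \<open>2\<^bsup>O(l)\<^esup> log n\<close> colourings of the vertices with \<open>l\<close> colours is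
  injective on every \<open>l\<close>-set for at least one member; it is found greedily, since a random
  colouring is injective on a given set with probability \<open>l! / l\<^sup>l \<ge> e\<^bsup>-l\<^esup>\<close>. For a fixed colouring
  and start vertex, the cycles on which the colouring is injective are the source-sink paths of
  the acyclic network whose nodes are pairs of a current vertex and a set of used colours; it has
  at most \<open>2\<^sup>l n\<^sup>2\<close> arcs. The extension is the polyhedron of unit flows in the disjoint union of all
  these networks, mapped to the edges traversed. A unit flow in a layered network is an average of
  paths, so the image is the cycle polytope, and each facet comes from one constraint \<open>y\<^sub>e \<ge> 0\<close>.
\<close>

section \<open>Facets and inequalities\<close>

text \<open>A facet is already cut out by one of its tight inequalities: some tight inequality is
  strict somewhere on \<open>Q\<close>, and a second dimension lost besides that one would
  contradict the dimension of a facet. So every facet has the form \<open>?G i\<close>, and there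
  are at most as many of them as indices. Equations enter through \<open>H\<close>; the finite
  spanning set \<open>T\<close> keeps all bases finite.\<close>

lemma card_facets_le:
  fixes Q :: "'a::real_vector set" and f :: "'i \<Rightarrow> 'a \<Rightarrow> real"
  assumes I: "finite I" and lin: "\<And>i. i \<in> I \<Longrightarrow> linear (f i)"
    and H: "affine H" "H \<subseteq> span T" "finite T"
    and Q: "Q = {y \<in> H. \<forall>i\<in>I. f i y \<le> b i}"
  shows "finite (facets Q) \<and> card (facets Q) \<le> card I"
proof -
  let ?G = "\<lambda>i. {z \<in> Q. f i z = b i}"
  have "facets Q \<subseteq> ?G ` I"
  proof
    fix F assume "F \<in> facets Q"
    then have face: "F face_of Q" and ne: "F \<noteq> {}"
      and dimF: "affine_dimension F = affine_dimension Q - 1"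
      by (auto simp: facets_def)
    then have FQ: "F \<subseteq> Q" and cF: "convex F" by (auto simp: face_of_def)
    define tight where "tight y = {i \<in> I. f i y = b i}" for y
    \<comment> \<open>With fewest tight inequalities, \<open>y0\<close> serves as a relative
      interior point of \<open>F\<close>. By \<open>t0\<close>, whatever is tight at
      \<open>y0\<close> is tight on all of \<open>F\<close>, since otherwise the midpoint with the
      offending point would have fewer tight inequalities.\<close>
    obtain y0 where y0: "y0 \<in> F" "\<And>y. y \<in> F \<Longrightarrow> card (tight y0) \<le> card (tight y)"
      using ex_has_least_nat[of "\<lambda>y. y \<in> F" _ "\<lambda>y. card (tight y)"] ne by blast
    have le: "f i y \<le> b i" if "y \<in> Q" "i \<in> I" for i y using that Q by auto
    have t0: "f i y = b i" if i: "i \<in> I" "f i y0 = b i" and y: "y \<in> F" for i y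
    proof (rule ccontr)
      assume n: "f i y \<noteq> b i"
      let ?z = "(1/2) *\<^sub>R y0 + (1/2) *\<^sub>R y"
      have z: "?z \<in> F" using cF y0(1) y by (simp add: convex_def)
      have fz: "f j ?z = (f j y0 + f j y) / 2" if "j \<in> I" for j
        using lin[OF that] by (simp add: linear_add linear_scale)
      have "tight ?z \<subset> tight y0"
      proof
        show "tight ?z \<subseteq> tight y0"
        proof
          fix j assume "j \<in> tight ?z"
          then have j: "j \<in> I" "f j ?z = b j" by (auto simp: tight_def)
          have "f j y0 \<le> b j" "f j y \<le> b j" using j le FQ y0(1) y by auto
          then show "j \<in> tight y0" using j fz[of j] by (auto simp: tight_def)
        qed
        have "f i ?z \<noteq> b i" using fz[OF i(1)] i n by auto
        then show "tight ?z \<noteq> tight y0" using i by (auto simp: tight_def)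
      qed
      then have "card (tight ?z) < card (tight y0)"
        by (intro psubset_card_mono) (auto simp: tight_def I)
      with y0(2)[OF z] show False by simp
    qed
    \<comment> \<open>The segment from \<open>z\<close> to \<open>y0\<close> can be prolonged a
      little beyond \<open>y0\<close> inside \<open>Q\<close>, to \<open>?w\<close>: inequalities
      tight at \<open>y0\<close> are constant along the line, the finitely many others have slack.
      Then \<open>y0\<close> is interior to a segment in \<open>Q\<close>, and the face property
      gives \<open>z \<in> F\<close>.\<close>
    have key: "z \<in> F" if z: "z \<in> Q" and tz: "\<And>i. i \<in> I \<Longrightarrow> f i y0 = b i \<Longrightarrow> f i z = b i" for z
    proof (cases "z = y0")
      case True then show ?thesis using y0 by simp
    next
      case False
      have "eventually (\<lambda>e. f i y0 + e * (f i y0 - f i z) \<le> b i) (at_right 0)" if i: "i \<in> I" for i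
      proof (cases "f i y0 = b i")
        case True then show ?thesis using tz[OF i] by simp
      next
        case False
        then have "f i y0 + 0 * (f i y0 - f i z) < b i" using le[OF _ i, of y0] y0(1) FQ by auto
        moreover have "((\<lambda>e. f i y0 + e * (f i y0 - f i z)) \<longlongrightarrow> f i y0 + 0 * (f i y0 - f i z)) (at_right 0)"
          by (intro tendsto_intros)
        ultimately have "eventually (\<lambda>e. f i y0 + e * (f i y0 - f i z) < b i) (at_right 0)"
          using order_tendstoD(2) by blast
        then show ?thesis by eventually_elim simp
      qed
      then have "eventually (\<lambda>e. \<forall>i\<in>I. f i y0 + e * (f i y0 - f i z) \<le> b i) (at_right 0)"
        using I by (simp add: eventually_ball_finite)
      then have "eventually (\<lambda>e. (\<forall>i\<in>I. f i y0 + e * (f i y0 - f i z) \<le> b i) \<and> e > 0) (at_right (0::real))"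
        using eventually_at_right_less by (rule eventually_conj)
      then obtain e where e: "e > 0" "\<And>i. i \<in> I \<Longrightarrow> f i y0 + e * (f i y0 - f i z) \<le> b i"
        using eventually_happens'[OF trivial_limit_at_right_real] by blast
      let ?w = "(1 + e) *\<^sub>R y0 + (- e) *\<^sub>R z"
      have "?w \<in> H" using H(1) z y0(1) FQ Q mem_affine[of H y0 z "1+e" "-e"] by auto
      moreover have "f i ?w \<le> b i" if "i \<in> I" for i
        using e(2)[OF that] lin[OF that]
        by (simp only: linear_add linear_scale real_scaleR_def) (simp add: algebra_simps)
      ultimately have w: "?w \<in> Q" using Q by auto
      have "z \<noteq> ?w"
      proof
        assume "z = ?w"
        then have "z - ?w = 0" by simp
        then have "(1 + e) *\<^sub>R (z - y0) = 0" by (simp add: algebra_simps)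
        then show False using e(1) False by simp
      qed
      moreover have "y0 = (1 - 1 / (1 + e)) *\<^sub>R z + (1 / (1 + e)) *\<^sub>R ?w"
      proof -
        define a where "a = 1 / (1 + e)"
        have a: "a * (1 + e) = 1" "a * (- e) = - (1 - a)" using e(1) by (auto simp: a_def field_simps)
        have "(1 - a) *\<^sub>R z + a *\<^sub>R ?w = (1 - a) *\<^sub>R z + ((a * (1 + e)) *\<^sub>R y0 + (a * (- e)) *\<^sub>R z)"
          by (simp only: scaleR_add_right scaleR_scaleR)
        also have "\<dots> = y0" unfolding a by (simp only: scaleR_minus_left) simp
        finally show ?thesis by (simp add: a_def)
      qed
      ultimately have "y0 \<in> open_segment z ?w"
        unfolding in_segment using e(1) by (intro conjI exI[of _ "1 / (1 + e)"]) (auto simp: field_simps)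
      then show "z \<in> F" using face z w y0(1) unfolding face_of_def by blast
    qed
    let ?D = "\<lambda>S. {x - y | x y. x \<in> S \<and> y \<in> (S::'a set)}"
    have fin: "finite B" if "independent B" "B \<subseteq> ?D Q" for B
    proof -
      have "?D Q \<subseteq> span T" using H(2) Q by (auto intro!: span_diff)
      then show ?thesis using independent_span_bound[OF H(3) that(1)] that(2) by auto
    qed
    \<comment> \<open>If every inequality tight at \<open>y0\<close> were an equation on
      \<open>Q\<close>, then \<open>key\<close> would give \<open>F = Q\<close>, against the drop in
      dimension.\<close>
    have "\<exists>i\<in>I. f i y0 = b i \<and> (\<exists>z\<in>Q. f i z \<noteq> b i)"
    proof (rule ccontr)
      assume "\<not> ?thesis"
      then have "Q \<subseteq> F" using key by blast
      then show False using FQ dimF by auto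
    qed
    then obtain i q where i: "i \<in> I" "f i y0 = b i" and q: "q \<in> Q" "f i q \<noteq> b i" by blast
    have zero: "f j v = 0" if "j \<in> I" "f j y0 = b j" "v \<in> span (?D F)" for j v
    proof -
      have "f j x = 0" if "x \<in> ?D F" for x
        using that t0[OF \<open>j \<in> I\<close> \<open>f j y0 = b j\<close>] linear_diff[OF lin[OF \<open>j \<in> I\<close>]] by auto
      then show ?thesis using linear_eq_0_on_span[OF lin[OF \<open>j \<in> I\<close>]] that(3) by blast
    qed
    have "?G i \<subseteq> F"
    proof
      fix z assume z: "z \<in> ?G i"
      obtain BF where BF: "BF \<subseteq> ?D F" "independent BF" "?D F \<subseteq> span BF" "card BF = dim (?D F)"
        using real_vector.basis_exists[of "?D F"] by blast
      obtain BQ where BQ: "BQ \<subseteq> ?D Q" "independent BQ" "?D Q \<subseteq> span BQ" "card BQ = dim (?D Q)"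
        using real_vector.basis_exists[of "?D Q"] by blast
      have DFQ: "?D F \<subseteq> ?D Q" using FQ by blast
      have finF: "finite BF" and finQ: "finite BQ" using fin BF BQ DFQ by auto
      have cards: "card BQ = card BF + 1"
        using dimF ne FQ BF(4) BQ(4) by (auto simp: affine_dimension_def split: if_splits)
      have sF: "span BF = span (?D F)"
        using BF(1,3) by (intro equalityI span_mono span_minimal subspace_span)
      \<comment> \<open>Otherwise \<open>z - y0\<close> and \<open>q - y0\<close> are two further
        independent directions in \<open>Q\<close>: \<open>f i\<close> vanishes on the directions of
        \<open>F\<close> and on the first, but not on the second. The dimensions of \<open>F\<close>
        and \<open>Q\<close> differ only by one.\<close>
      have "z - y0 \<in> span BF"
      proof (rule ccontr)
        assume a: "z - y0 \<notin> span BF"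
        have fi: "f i v = 0" if "v \<in> span (insert (z - y0) BF)" for v
        proof -
          have "f i x = 0" if "x \<in> insert (z - y0) BF" for x
            using that zero[OF i, of x] sF span_base[of x BF] z i(2) linear_diff[OF lin[OF i(1)]]
            by auto
          then show ?thesis using linear_eq_0_on_span[OF lin[OF i(1)]] that by blast
        qed
        have nq: "q - y0 \<notin> span (insert (z - y0) BF)"
          using fi q(2) i(2) linear_diff[OF lin[OF i(1)]] by fastforce
        have "independent (insert (q - y0) (insert (z - y0) BF))"
          using a nq BF(2) by (meson real_vector.independent_insertI)
        moreover have "insert (q - y0) (insert (z - y0) BF) \<subseteq> span BQ"
          using BQ(3) BF(1) DFQ q z y0(1) FQ by blast
        ultimately have "card (insert (q - y0) (insert (z - y0) BF)) \<le> card BQ"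
          using independent_span_bound[OF finQ] by blast
        moreover have "z - y0 \<notin> BF" "q - y0 \<notin> insert (z - y0) BF"
          using a nq real_vector.span_base by blast+
        ultimately show False using cards finF by simp
      qed
      then have zs: "z - y0 \<in> span (?D F)" using sF by simp
      show "z \<in> F"
      proof (rule key)
        show "z \<in> Q" using z by simp
        show "f j z = b j" if "j \<in> I" "f j y0 = b j" for j
          using zero[OF that zs] that linear_diff[OF lin[OF that(1)]] by simp
      qed
    qed
    moreover have "F \<subseteq> ?G i" using t0[OF i] FQ by blast
    ultimately show "F \<in> ?G ` I" using i(1) by blast
  qed
  then show ?thesis using I by (meson card_image_le card_mono finite_imageI finite_subset le_trans)
qed

section \<open>Flows in layered networks\<close>

text \<open>The multiple \<open>t\<close> of the convex hull, with the value \<open>{0}\<close> at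
  \<open>t = 0\<close> even if \<open>R\<close> is empty. This lets nodes that receive no flow take
  part in the sums.\<close>

definition weighted_hull :: "'a::real_vector set \<Rightarrow> real \<Rightarrow> 'a set" where
  "weighted_hull R t = {u. 0 \<le> t \<and> (if t = 0 then u = 0 else \<exists>z \<in> convex hull R. u = t *\<^sub>R z)}"

lemma weighted_hull_zero: "0 \<in> weighted_hull R 0"
  by (simp add: weighted_hull_def)

lemma weighted_hull_one: "u \<in> weighted_hull R 1 \<Longrightarrow> u \<in> convex hull R"
  by (auto simp: weighted_hull_def)

lemma weighted_hull_mono: "R \<subseteq> R' \<Longrightarrow> u \<in> weighted_hull R t \<Longrightarrow> u \<in> weighted_hull R' t"
  using hull_mono[of R R' convex] by (auto simp: weighted_hull_def split: if_splits)

lemma weighted_hull_add: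
  assumes "u \<in> weighted_hull R s" "v \<in> weighted_hull R t"
  shows "u + v \<in> weighted_hull R (s + t)"
proof (cases "s = 0 \<or> t = 0")
  case True
  then show ?thesis using assms by (auto simp: weighted_hull_def split: if_splits)
next
  case False
  then have pos: "s > 0" "t > 0" using assms by (auto simp: weighted_hull_def)
  obtain x y where xy: "x \<in> convex hull R" "y \<in> convex hull R" "u = s *\<^sub>R x" "v = t *\<^sub>R y"
    using assms False by (auto simp: weighted_hull_def)
  let ?z = "(s / (s + t)) *\<^sub>R x + (t / (s + t)) *\<^sub>R y"
  have "?z \<in> convex hull R"
    using pos xy by (intro convexD[OF convex_convex_hull]) (auto simp: add_divide_distrib[symmetric])
  moreover have "u + v = (s + t) *\<^sub>R ?z"
    using pos xy by (simp add: scaleR_add_right)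
  ultimately show ?thesis using pos by (auto simp: weighted_hull_def)
qed

lemma weighted_hull_sum:
  assumes "finite J" "\<And>j. j \<in> J \<Longrightarrow> u j \<in> weighted_hull R (t j)"
  shows "(\<Sum>j\<in>J. u j) \<in> weighted_hull R (\<Sum>j\<in>J. t j)"
  using assms by (induction J) (auto intro: weighted_hull_zero weighted_hull_add)

lemma weighted_hull_scale:
  assumes "u \<in> weighted_hull R t" "0 \<le> s"
  shows "s *\<^sub>R u \<in> weighted_hull R (s * t)"
  using assms by (auto simp: weighted_hull_def split: if_splits)

text \<open>Appends an arc of cost \<open>c\<close> to all paths that together carry
  \<open>t\<close> units of flow.\<close>

lemma weighted_hull_translate:
  assumes "u \<in> weighted_hull R t" "\<And>z. z \<in> R \<Longrightarrow> z + c \<in> R'"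
  shows "u + t *\<^sub>R c \<in> weighted_hull R' t"
proof -
  have "z + c \<in> convex hull R'" if "z \<in> convex hull R" for z
  proof -
    have "(\<lambda>z. c + z) ` (convex hull R) = convex hull ((\<lambda>z. c + z) ` R)"
      by (rule convex_hull_translation[symmetric])
    moreover have "convex hull ((\<lambda>z. c + z) ` R) \<subseteq> convex hull R'"
      using assms(2) by (intro hull_mono) (auto simp: add.commute)
    ultimately show ?thesis using that by (force simp: add.commute)
  qed
  then show ?thesis using assms(1)
    by (auto simp: weighted_hull_def scaleR_add_right[symmetric] split: if_splits)
qed

text \<open>
  Flow decomposition: the part of the cost incurred before layer \<open>k\<close> is distributed over the
  nodes of layer \<open>k\<close>, each receiving its inflow times an average of costs of paths ending there.
\<close>

lemma layered_flow_cost: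
  fixes E :: "('v \<times> 'v) set" and c :: "'v \<times> 'v \<Rightarrow> 'b::real_vector" and y :: "'v \<times> 'v \<Rightarrow> real"
  assumes E: "finite E" and r: "\<And>a b. (a, b) \<in> E \<Longrightarrow> r b = Suc (r a) \<and> r a < L"
    and y: "\<And>e. e \<in> E \<Longrightarrow> 0 \<le> y e"
    and cons: "\<And>v. 0 < r v \<Longrightarrow> r v < L \<Longrightarrow> (\<Sum>e | e \<in> E \<and> snd e = v. y e) = (\<Sum>e | e \<in> E \<and> fst e = v. y e)"
    and one: "(\<Sum>e | e \<in> E \<and> r (fst e) = 0. y e) = 1"
    and R0: "\<And>a b. (a, b) \<in> E \<Longrightarrow> r a = 0 \<Longrightarrow> 0 \<in> R a"
    and R: "\<And>a b z. (a, b) \<in> E \<Longrightarrow> z \<in> R a \<Longrightarrow> z + c (a, b) \<in> R b"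
  shows "(\<Sum>e\<in>E. y e *\<^sub>R c e) \<in> convex hull (\<Union>v\<in>{v \<in> snd ` E. r v = L}. R v)"
proof -
  define V where "V = fst ` E \<union> snd ` E"
  define N where "N k = {v \<in> V. r v = k}" for k
  define outf where "outf v = (\<Sum>e | e \<in> E \<and> fst e = v. y e)" for v
  define inf where "inf v = (\<Sum>e | e \<in> E \<and> snd e = v. y e)" for v
  \<comment> \<open>The flow through \<open>v\<close>. Layer 0 has no inflow and layer
    \<open>L\<close> no outflow; by \<open>t_out\<close>, outflow is the right value on every layer
    below \<open>L\<close>.\<close>
  define t where "t k v = (if k = 0 then outf v else inf v)" for k :: nat and v
  have fV: "finite V" using E by (simp add: V_def)
  then have fN: "finite (N k)" for k by (simp add: N_def)
  \<comment> \<open>The arcs between layers \<open>k\<close> and \<open>k + 1\<close> are grouped by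
    tail here and by head in \<open>inl\<close>; comparing the two groupings passes from one layer
    to the next.\<close>
  have outl: "(\<Sum>e | e \<in> E \<and> r (fst e) = k. g e) = (\<Sum>v\<in>N k. \<Sum>e | e \<in> E \<and> fst e = v. g e)" 
    for k and g :: "_ \<Rightarrow> 'x::comm_monoid_add"
  proof -
    have "(\<Sum>v\<in>N k. \<Sum>e | e \<in> {e\<in>E. r (fst e) = k} \<and> fst e = v. g e) = (\<Sum>e | e \<in> E \<and> r (fst e) = k. g e)"
      using E fN by (intro sum.group) (auto simp: N_def V_def)
    moreover have "{e. e \<in> {e\<in>E. r (fst e) = k} \<and> fst e = v} = {e. e \<in> E \<and> fst e = v}" if "v \<in> N k" for v
      using that by (auto simp: N_def)
    ultimately show ?thesis by simp
  qed
  have inl: "(\<Sum>e | e \<in> E \<and> r (fst e) = k. g e) = (\<Sum>v\<in>N (Suc k). \<Sum>e | e \<in> E \<and> snd e = v. g e)" 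
    for k and g :: "_ \<Rightarrow> 'x::comm_monoid_add"
  proof -
    have "(\<Sum>v\<in>N (Suc k). \<Sum>e | e \<in> {e\<in>E. r (fst e) = k} \<and> snd e = v. g e) = (\<Sum>e | e \<in> E \<and> r (fst e) = k. g e)"
      using E fN r by (intro sum.group) (auto simp: N_def V_def)
    moreover have "{e. e \<in> {e\<in>E. r (fst e) = k} \<and> snd e = v} = {e. e \<in> E \<and> snd e = v}" if "v \<in> N (Suc k)" for v
      using that r by (auto simp: N_def)
    ultimately show ?thesis by simp
  qed
  have t_out: "t k v = outf v" if "v \<in> N k" "k < L" for k v
    using that cons[of v] by (auto simp: t_def N_def outf_def inf_def)
  have L: "0 < L" 
  proof (rule ccontr)
    assume "\<not> 0 < L"
    then have "E = {}" using r by auto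
    then show False using one by simp
  qed
  have main: "k \<le> L \<Longrightarrow> \<exists>u. (\<forall>v\<in>N k. u v \<in> weighted_hull (R v) (t k v)) \<and> 
      (\<Sum>e | e \<in> E \<and> r (fst e) < k. y e *\<^sub>R c e) = (\<Sum>v\<in>N k. u v)" for k
  proof (induction k)
    case 0
    have "0 \<in> weighted_hull (R v) (t 0 v)" if v: "v \<in> N 0" for v
    proof -
      obtain b where "(v, b) \<in> E" using v r by (force simp: N_def V_def)
      then have "0 \<in> convex hull (R v)" using R0[of v b] v by (auto simp: N_def intro: hull_inc)
      moreover have "0 \<le> t 0 v" using y by (auto simp: t_def outf_def intro!: sum_nonneg)
      ultimately show ?thesis by (auto simp: weighted_hull_def intro!: bexI[of _ 0])
    qed
    then show ?case by (intro exI[of _ "\<lambda>_. 0"]) simp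
  next
    case (Suc k)
    then obtain u where u: "\<And>v. v \<in> N k \<Longrightarrow> u v \<in> weighted_hull (R v) (outf v)"
      and eq: "(\<Sum>e | e \<in> E \<and> r (fst e) < k. y e *\<^sub>R c e) = (\<Sum>v\<in>N k. u v)"
      using t_out by auto
    \<comment> \<open>The accumulated cost at the tail is split over the outgoing arcs in proportion
      to their flow, and each arc adds its own cost. For zero outflow the quotient is 0 by
      convention, which is correct since then \<open>y e = 0\<close> by \<open>out0\<close>.\<close>
    define x where "x e = (y e / outf (fst e)) *\<^sub>R u (fst e) + y e *\<^sub>R c e" for e
    have out0: "y e = 0" if "e \<in> E" "outf (fst e) = 0" for e
    proof -
      have "\<forall>e'\<in>{e'. e' \<in> E \<and> fst e' = fst e}. y e' = 0"
        using that y E by (subst sum_nonneg_eq_0_iff[symmetric]) (auto simp: outf_def)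
      then show ?thesis using that(1) by (metis (mono_tags, lifting) mem_Collect_eq)
    qed
    have xe: "x e \<in> weighted_hull (R (snd e)) (y e)" if e: "e \<in> E" "r (fst e) = k" for e
    proof -
      have vN: "fst e \<in> N k" using e by (auto simp: N_def V_def)
      have "outf (fst e) \<ge> 0" using y by (auto simp: outf_def intro!: sum_nonneg)
      then have "(y e / outf (fst e)) *\<^sub>R u (fst e) \<in> weighted_hull (R (fst e)) (y e / outf (fst e) * outf (fst e))"
        using y[OF e(1)] by (intro weighted_hull_scale u vN) auto
      also have "y e / outf (fst e) * outf (fst e) = y e" using out0[OF e(1)] by auto
      finally show ?thesis unfolding x_def using R[of "fst e" "snd e"] e(1) by (intro weighted_hull_translate) auto
    qed
    define u' where "u' w = (\<Sum>e | e \<in> E \<and> snd e = w. x e)" for w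
    have "u' w \<in> weighted_hull (R w) (t (Suc k) w)" if w: "w \<in> N (Suc k)" for w
    proof -
      have "u' w \<in> weighted_hull (R w) (\<Sum>e | e \<in> E \<and> snd e = w. y e)"
        unfolding u'_def
      proof (rule weighted_hull_sum)
        show "finite {e \<in> E. snd e = w}" using E by simp
        fix e assume "e \<in> {e \<in> E. snd e = w}"
        then show "x e \<in> weighted_hull (R w) (y e)" using xe[of e] w r[of "fst e" "snd e"] by (auto simp: N_def)
      qed
      then show ?thesis by (simp add: t_def inf_def)
    qed
    moreover have "(\<Sum>e | e \<in> E \<and> r (fst e) < Suc k. y e *\<^sub>R c e) = (\<Sum>v\<in>N (Suc k). u' v)"
    proof -
      have "(\<Sum>v\<in>N (Suc k). u' v) = (\<Sum>e | e \<in> E \<and> r (fst e) = k. x e)"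
        unfolding u'_def by (rule inl[symmetric])
      also have "\<dots> = (\<Sum>e | e \<in> E \<and> r (fst e) = k. (y e / outf (fst e)) *\<^sub>R u (fst e)) + (\<Sum>e | e \<in> E \<and> r (fst e) = k. y e *\<^sub>R c e)"
        unfolding x_def by (rule sum.distrib)
      also have "(\<Sum>e | e \<in> E \<and> r (fst e) = k. (y e / outf (fst e)) *\<^sub>R u (fst e)) = (\<Sum>v\<in>N k. u v)"
      proof -
        have "(\<Sum>e | e \<in> E \<and> fst e = v. (y e / outf (fst e)) *\<^sub>R u (fst e)) = u v" if "v \<in> N k" for v
        proof -
          have "(\<Sum>e | e \<in> E \<and> fst e = v. (y e / outf (fst e)) *\<^sub>R u (fst e)) = (\<Sum>e | e \<in> E \<and> fst e = v. y e / outf v) *\<^sub>R u v"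
            unfolding scaleR_sum_left by (intro sum.cong) auto
          also have "(\<Sum>e | e \<in> E \<and> fst e = v. y e / outf v) = outf v / outf v"
            unfolding sum_divide_distrib[symmetric] by (simp add: outf_def)
          \<comment> \<open>If \<open>outf v = 0\<close>, the quotient is 0, but then
            \<open>u v\<close> has weight 0 and is itself 0.\<close>
          also have "(outf v / outf v) *\<^sub>R u v = u v"
            using u[OF that] by (auto simp: weighted_hull_def)
          finally show ?thesis .
        qed
        then show ?thesis unfolding outl by simp
      qed
      also have "\<dots> = (\<Sum>e | e \<in> E \<and> r (fst e) < k. y e *\<^sub>R c e)" using eq by simp
      also have "\<dots> + (\<Sum>e | e \<in> E \<and> r (fst e) = k. y e *\<^sub>R c e) = (\<Sum>e \<in> {e\<in>E. r (fst e) < k} \<union> {e\<in>E. r (fst e) = k}. y e *\<^sub>R c e)"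
        using E by (subst sum.union_disjoint) auto
      also have "{e\<in>E. r (fst e) < k} \<union> {e\<in>E. r (fst e) = k} = {e. e\<in>E \<and> r (fst e) < Suc k}" by auto
      finally show ?thesis by simp
    qed
    ultimately show ?case by blast
  qed
  obtain u where u: "\<And>v. v \<in> N L \<Longrightarrow> u v \<in> weighted_hull (R v) (t L v)"
    and eq: "(\<Sum>e | e \<in> E \<and> r (fst e) < L. y e *\<^sub>R c e) = (\<Sum>v\<in>N L. u v)"
    using main[of L] by auto
  \<comment> \<open>The unit leaving layer 0 is preserved from layer to layer, so the final weights
    sum to 1 and the sum is a genuine convex combination.\<close>
  have lay: "(\<Sum>v\<in>N k. t k v) = 1" if "k \<le> L" for k
    using that
  proof (induction k)
    case 0
    then show ?case using one unfolding outl by (simp add: t_def outf_def)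
  next
    case (Suc k)
    have "(\<Sum>v\<in>N (Suc k). t (Suc k) v) = (\<Sum>e | e \<in> E \<and> r (fst e) = k. y e)"
      by (simp add: t_def inf_def inl)
    also have "\<dots> = (\<Sum>v\<in>N k. outf v)" by (simp add: outl outf_def)
    also have "\<dots> = (\<Sum>v\<in>N k. t k v)" using Suc.prems t_out by (intro sum.cong) auto
    finally show ?case using Suc by simp
  qed
  have NL: "N L \<subseteq> {v \<in> snd ` E. r v = L}" using r by (force simp: N_def V_def)
  have "(\<Sum>v\<in>N L. u v) \<in> weighted_hull (\<Union>v\<in>{v \<in> snd ` E. r v = L}. R v) (\<Sum>v\<in>N L. t L v)"
  proof (intro weighted_hull_sum fN)
    fix v assume "v \<in> N L"
    then show "u v \<in> weighted_hull (\<Union>v\<in>{v \<in> snd ` E. r v = L}. R v) (t L v)"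
      using NL by (intro weighted_hull_mono[OF _ u] UN_upper) blast+
  qed
  moreover have "{e \<in> E. r (fst e) < L} = E" using r by force
  ultimately show ?thesis using lay[of L] eq weighted_hull_one by fastforce
qed

section \<open>Unit flows as a polyhedron\<close>

text \<open>Nodes of rank 0 and \<open>L\<close> are sources and sinks, free from conservation. The
  unit may be shared among all sources, so that a disjoint union of networks yields convex
  combinations across its members.\<close>

definition unit_flow :: "('v \<times> 'v) set \<Rightarrow> ('v \<Rightarrow> nat) \<Rightarrow> nat \<Rightarrow> ('v \<times> 'v \<Rightarrow> real) \<Rightarrow> bool" where
  "unit_flow E r L y \<longleftrightarrow> (\<forall>e\<in>E. 0 \<le> y e) \<and>
     (\<forall>v. 0 < r v \<and> r v < L \<longrightarrow> (\<Sum>e | e \<in> E \<and> snd e = v. y e) = (\<Sum>e | e \<in> E \<and> fst e = v. y e)) \<and>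
     (\<Sum>e | e \<in> E \<and> r (fst e) = 0. y e) = 1"

lemma unit_flow_cong:
  assumes "unit_flow E r L y" "\<And>e. e \<in> E \<Longrightarrow> y' e = y e"
  shows "unit_flow E r L y'"
proof -
  have "(\<Sum>e | e \<in> E \<and> P e. y' e) = (\<Sum>e | e \<in> E \<and> P e. y e)" for P
    using assms(2) by (intro sum.cong) auto
  then show ?thesis using assms by (simp add: unit_flow_def)
qed

lemma lookup_scaleR: "Poly_Mapping.lookup (u *\<^sub>R x) i = u *\<^sub>R Poly_Mapping.lookup x i"
  by (auto simp: scaleR_poly_mapping_def lookup_Abs_poly_mapping intro: finite_subset[OF _ finite_lookup])

lemma linear_linear_form: "linear (linear_form d a)"
  by (intro linearI) (simp_all add: linear_form_def lookup_add lookup_scaleR algebra_simps sum.distrib sum_distrib_left)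

text \<open>There is one coordinate and one inequality \<open>- y \<le> 0\<close> per arc, one
  equation per inner node, and one equation for the unit value. Only the inequalities count in
  \<open>card_facets_le\<close>. The projection adds up the coordinates of all arcs with the same
  label.\<close>

lemma flow_polyhedron:
  fixes E :: "('v \<times> 'v) set" and lab :: "'v \<times> 'v \<Rightarrow> 'e"
  assumes E: "finite E" and W: "finite W" "lab ` E \<subseteq> W"
  obtains d m A b k B c T t where
    "rat_affine_map W d T t ` rat_polyhedron d m A b k B c =
       (\<lambda>y. \<Sum>e\<in>E. y e *\<^sub>R Poly_Mapping.single (lab e) 1) ` {y. unit_flow E r L y}"
    "finite (facets (rat_polyhedron d m A b k B c))"
    "card (facets (rat_polyhedron d m A b k B c)) \<le> card E"
    "\<And>i j. A i j \<in> {0, 1, -1}" "\<And>i. b i \<in> {0, 1, -1}"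
    "\<And>i j. B i j \<in> {0, 1, -1}" "\<And>i. c i \<in> {0, 1, -1}"
    "\<And>e j. T e j \<in> {0, 1, -1}" "\<And>e. t e \<in> {0, 1, -1}"
proof -
  define d where "d = card E"
  \<comment> \<open>Nodes touched by no arc have both conservation sums empty, so these finitely
    many rows express conservation everywhere.\<close>
  define N where "N = {v \<in> fst ` E \<union> snd ` E. 0 < r v \<and> r v < L}"
  define p where "p = card N"
  have fN: "finite N" using E by (simp add: N_def)
  obtain g where g: "bij_betw g {..<d} E"
    using ex_bij_betw_nat_finite[OF E] by (auto simp: d_def atLeast0LessThan)
  obtain h where h: "bij_betw h {..<p} N"
    using ex_bij_betw_nat_finite[OF fN] by (auto simp: p_def atLeast0LessThan)
  define A :: "nat \<Rightarrow> nat \<Rightarrow> rat" where "A i j = (if i = j then -1 else 0)" for i j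
  \<comment> \<open>Rows below \<open>p\<close> are conservation at \<open>h i\<close>; row
    \<open>p\<close> is the unit value.\<close>
  define B :: "nat \<Rightarrow> nat \<Rightarrow> rat" where
    "B i j = (if i < p then of_bool (snd (g j) = h i) - of_bool (fst (g j) = h i)
      else of_bool (r (fst (g j)) = 0))" for i j
  define c :: "nat \<Rightarrow> rat" where "c i = (if i < p then 0 else 1)" for i
  define T :: "'e \<Rightarrow> nat \<Rightarrow> rat" where "T w j = of_bool (lab (g j) = w)" for w j
  define Q where "Q = rat_polyhedron d d A (\<lambda>_. 0) (Suc p) B c"
  define Y where "Y y e = Poly_Mapping.lookup y (the_inv_into {..<d} g e)" for y :: "nat \<Rightarrow>\<^sub>0 real" and e
  have Yg: "Y y (g j) = Poly_Mapping.lookup y j" if "j < d" for y j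
    using g that by (simp add: Y_def the_inv_into_f_f bij_betw_def)
  have gE: "g j \<in> E" if "j < d" for j using g that by (auto simp: bij_betw_def)
  have form: "(\<Sum>j<d. F (g j) * Poly_Mapping.lookup y j) = (\<Sum>e\<in>E. F e * Y y e)" for F y
  proof -
    have "(\<Sum>e\<in>E. F e * Y y e) = (\<Sum>j<d. F (g j) * Y y (g j))"
      by (rule sum.reindex_bij_betw[OF g, symmetric])
    then show ?thesis using Yg by simp
  qed
  have filter: "(\<Sum>e\<in>E. of_bool (P e) * x e) = (\<Sum>e | e \<in> E \<and> P e. x e)" for P and x :: "_ \<Rightarrow> real"
    using E by (intro sum.mono_neutral_cong_right) auto
  have formA: "linear_form d (A i) y = - Poly_Mapping.lookup y i" if "i < d" for i y
  proof -
    have "linear_form d (A i) y = (\<Sum>j<d. if j = i then - Poly_Mapping.lookup y j else 0)"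
      unfolding linear_form_def A_def by (intro sum.cong) auto
    then show ?thesis using that by simp
  qed
  have formB: "linear_form d (B i) y = (\<Sum>e | e \<in> E \<and> snd e = h i. Y y e) - (\<Sum>e | e \<in> E \<and> fst e = h i. Y y e)"
    if "i < p" for i y
  proof -
    have "linear_form d (B i) y = (\<Sum>j<d. (of_bool (snd (g j) = h i) - of_bool (fst (g j) = h i)) * Poly_Mapping.lookup y j)"
      unfolding linear_form_def B_def using that by (intro sum.cong) auto
    also have "\<dots> = (\<Sum>e\<in>E. (of_bool (snd e = h i) - of_bool (fst e = h i)) * Y y e)"
      by (rule form)
    also have "\<dots> = (\<Sum>e\<in>E. of_bool (snd e = h i) * Y y e) - (\<Sum>e\<in>E. of_bool (fst e = h i) * Y y e)"
      by (simp only: left_diff_distrib sum_subtractf)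
    finally show ?thesis by (simp only: filter)
  qed
  have formB': "linear_form d (B p) y = (\<Sum>e | e \<in> E \<and> r (fst e) = 0. Y y e)" for y
  proof -
    have "linear_form d (B p) y = (\<Sum>j<d. of_bool (r (fst (g j)) = 0) * Poly_Mapping.lookup y j)"
      unfolding linear_form_def B_def by (intro sum.cong) auto
    also have "\<dots> = (\<Sum>e\<in>E. of_bool (r (fst e) = 0) * Y y e)" by (rule form)
    finally show ?thesis by (simp only: filter)
  qed
  have memQ: "y \<in> Q \<longleftrightarrow> Poly_Mapping.keys y \<subseteq> {..<d} \<and> unit_flow E r L (Y y)" for y
  proof -
    have "(\<forall>i<d. linear_form d (A i) y \<le> of_rat 0) \<longleftrightarrow> (\<forall>e\<in>E. 0 \<le> Y y e)"
    proof -
      have "(\<forall>e\<in>E. 0 \<le> Y y e) \<longleftrightarrow> (\<forall>e\<in>g ` {..<d}. 0 \<le> Y y e)"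
        using g by (simp add: bij_betw_def)
      then show ?thesis using formA Yg by auto
    qed
    moreover have "(\<forall>i<Suc p. linear_form d (B i) y = of_rat (c i)) \<longleftrightarrow>
      (\<forall>v. 0 < r v \<and> r v < L \<longrightarrow> (\<Sum>e | e \<in> E \<and> snd e = v. Y y e) = (\<Sum>e | e \<in> E \<and> fst e = v. Y y e)) \<and>
      (\<Sum>e | e \<in> E \<and> r (fst e) = 0. Y y e) = 1" (is "_ \<longleftrightarrow> (\<forall>v. ?P v \<longrightarrow> ?in v = ?out v) \<and> _")
    proof -
      have "(\<forall>v. ?P v \<longrightarrow> ?in v = ?out v) \<longleftrightarrow> (\<forall>v\<in>N. ?in v = ?out v)"
      proof
        assume a: "\<forall>v\<in>N. ?in v = ?out v"
        show "\<forall>v. ?P v \<longrightarrow> ?in v = ?out v"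
        proof (intro allI impI)
          fix v assume v: "?P v"
          show "?in v = ?out v"
          proof (cases "v \<in> N")
            case False
            then have "{e. e \<in> E \<and> snd e = v} = {}" "{e. e \<in> E \<and> fst e = v} = {}"
              using v by (force simp: N_def)+
            then show ?thesis by (simp only: sum.empty)
          qed (use a in blast)
        qed
      qed (auto simp: N_def)
      also have "\<dots> \<longleftrightarrow> (\<forall>v\<in>h ` {..<p}. ?in v = ?out v)"
        using h by (simp add: bij_betw_def)
      also have "\<dots> \<longleftrightarrow> (\<forall>i<p. linear_form d (B i) y = of_rat (c i))"
        using formB by (auto simp: c_def)
      finally show ?thesis using formB' by (auto simp: c_def less_Suc_eq)
    qed
    ultimately show ?thesis unfolding Q_def rat_polyhedron_def unit_flow_def by blast
  qed
  have map: "rat_affine_map W d T (\<lambda>_. 0) y = (\<Sum>e\<in>E. Y y e *\<^sub>R Poly_Mapping.single (lab e) 1)" for y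
  proof -
    have lf: "linear_form d (T w) y = (\<Sum>e\<in>E. of_bool (lab e = w) * Y y e)" for w
    proof -
      have "linear_form d (T w) y = (\<Sum>j<d. of_bool (lab (g j) = w) * Poly_Mapping.lookup y j)"
        unfolding linear_form_def T_def by (intro sum.cong) auto
      then show ?thesis by (simp only: form[of "\<lambda>e. of_bool (lab e = w)"])
    qed
    show ?thesis
    proof (rule poly_mapping_eqI)
      fix x
      have "Poly_Mapping.lookup (rat_affine_map W d T (\<lambda>_. 0) y) x
        = (\<Sum>w\<in>W. if x = w then linear_form d (T w) y else 0)"
        unfolding rat_affine_map_def by (auto simp: lookup_sum lookup_scaleR lookup_single when_def intro!: sum.cong)
      also have "\<dots> = (if x \<in> W then linear_form d (T x) y else 0)" using W(1) by simp
      also have "\<dots> = (\<Sum>e\<in>E. of_bool (lab e = x) * Y y e)"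
        using W(2) by (auto simp: lf intro!: sum.neutral)
      also have "\<dots> = Poly_Mapping.lookup (\<Sum>e\<in>E. Y y e *\<^sub>R Poly_Mapping.single (lab e) 1) x"
        by (auto simp: lookup_sum lookup_scaleR lookup_single when_def intro!: sum.cong)
      finally show "Poly_Mapping.lookup (rat_affine_map W d T (\<lambda>_. 0) y) x =
        Poly_Mapping.lookup (\<Sum>e\<in>E. Y y e *\<^sub>R Poly_Mapping.single (lab e) 1) x" .
    qed
  qed
  have "rat_affine_map W d T (\<lambda>_. 0) ` Q =
       (\<lambda>y. \<Sum>e\<in>E. y e *\<^sub>R Poly_Mapping.single (lab e) 1) ` {y. unit_flow E r L y}"
  proof (intro equalityI subsetI)
    fix z :: "'e \<Rightarrow>\<^sub>0 real" assume "z \<in> (\<lambda>y. \<Sum>e\<in>E. y e *\<^sub>R Poly_Mapping.single (lab e) 1) ` {y. unit_flow E r L y}"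
    then obtain y where y: "unit_flow E r L y" "z = (\<Sum>e\<in>E. y e *\<^sub>R Poly_Mapping.single (lab e) 1)" by auto
    \<comment> \<open>The values of \<open>y\<close> outside \<open>E\<close> are arbitrary;
      \<open>x\<close> keeps those on arcs, and \<open>unit_flow_cong\<close> shows that this
      suffices.\<close>
    define x where "x = (\<Sum>j<d. Poly_Mapping.single j (y (g j)))"
    have lx: "Poly_Mapping.lookup x j = (if j < d then y (g j) else 0)" for j
      by (simp add: x_def lookup_sum lookup_scaleR lookup_single when_def)
    have Yx: "Y x e = y e" if "e \<in> E" for e
    proof -
      from that obtain j where "j < d" "e = g j" using g by (auto simp: bij_betw_def)
      then show ?thesis using Yg lx by simp
    qed
    have "Poly_Mapping.keys x \<subseteq> {..<d}" using lx by (auto simp: in_keys_iff split: if_splits)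
    then have "x \<in> Q" using memQ unit_flow_cong[OF y(1)] Yx by blast
    moreover have "rat_affine_map W d T (\<lambda>_. 0) x = z" using map Yx y(2) by simp
    ultimately show "z \<in> rat_affine_map W d T (\<lambda>_. 0) ` Q" by blast
  qed (use map memQ in auto)
  moreover have "finite (facets Q) \<and> card (facets Q) \<le> card {..<d}"
  proof (rule card_facets_le)
    \<comment> \<open>Support condition and equations form the ambient affine space, spanned within
      the unit vectors \<open>?T\<close>; the \<open>d\<close> sign constraints remain as the
      inequalities to be counted.\<close>
    let ?H = "{y. Poly_Mapping.keys y \<subseteq> {..<d} \<and> (\<forall>i<Suc p. linear_form d (B i) y = of_rat (c i))}"
    let ?T = "(\<lambda>j. Poly_Mapping.single j (1::real)) ` {..<d}"
    show "affine ?H"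
      unfolding affine_def
    proof (intro ballI allI impI)
      fix x y :: "nat \<Rightarrow>\<^sub>0 real" and u v :: real
      assume x: "x \<in> ?H" and y: "y \<in> ?H" and uv: "u + v = 1"
      have "Poly_Mapping.keys (u *\<^sub>R x + v *\<^sub>R y) \<subseteq> {..<d}"
      proof
        fix j assume "j \<in> Poly_Mapping.keys (u *\<^sub>R x + v *\<^sub>R y)"
        then have "j \<in> Poly_Mapping.keys x \<or> j \<in> Poly_Mapping.keys y"
          by (auto simp: in_keys_iff lookup_add lookup_scaleR)
        then show "j \<in> {..<d}" using x y by blast
      qed
      moreover have "linear_form d (B i) (u *\<^sub>R x + v *\<^sub>R y) = of_rat (c i)" if "i < Suc p" for i
        using x y uv that linear_linear_form[of d "B i"]
        by (simp add: linear_add linear_scale distrib_right[symmetric])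
      ultimately show "u *\<^sub>R x + v *\<^sub>R y \<in> ?H" by blast
    qed
    show "?H \<subseteq> span ?T"
    proof
      fix y :: "nat \<Rightarrow>\<^sub>0 real" assume y: "y \<in> ?H"
      have "y = (\<Sum>j<d. Poly_Mapping.lookup y j *\<^sub>R Poly_Mapping.single j 1)"
        using y by (intro poly_mapping_eqI)
          (auto simp: lookup_sum lookup_scaleR lookup_single when_def in_keys_iff if_distrib[of "\<lambda>x. _ * x"] cong: if_cong)
      also have "\<dots> \<in> span ?T" by (intro span_sum span_scale span_base) auto
      finally show "y \<in> span ?T" .
    qed
    show "Q = {y \<in> ?H. \<forall>i\<in>{..<d}. linear_form d (A i) y \<le> of_rat 0}"
      by (auto simp: Q_def rat_polyhedron_def)
  qed (auto intro: linear_linear_form)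
  ultimately show thesis
    by (intro that[of d T "\<lambda>_. 0" d A "\<lambda>_. 0" "Suc p" B c]) (auto simp: Q_def d_def A_def B_def c_def T_def)
qed

section \<open>Perfect hash families\<close>

text \<open>Since each \<open>s\<close> is hit by a fraction \<open>p\<close> of \<open>H\<close>,
  on average a member of \<open>H\<close> hits a fraction \<open>p\<close> of the elements still
  missed. Choosing one that does at least as well shrinks the missed set by the factor
  \<open>1 - p\<close>.\<close>

lemma greedy_cover:
  fixes p :: real
  assumes H: "finite H" "H \<noteq> {}" and S: "finite S" and p: "p \<le> 1"
    and hit: "\<And>s. s \<in> S \<Longrightarrow> p * real (card H) \<le> real (card {h \<in> H. hit h s})"
  shows "\<exists>hs. length hs = q \<and> set hs \<subseteq> H \<and>
    real (card {s \<in> S. \<forall>h\<in>set hs. \<not> hit h s}) \<le> (1 - p) ^ q * real (card S)"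
proof (induction q)
  case 0
  then show ?case by simp
next
  case (Suc q)
  then obtain hs where hs: "length hs = q" "set hs \<subseteq> H"
    "real (card {s \<in> S. \<forall>h\<in>set hs. \<not> hit h s}) \<le> (1 - p) ^ q * real (card S)" by blast
  let ?U = "{s \<in> S. \<forall>h\<in>set hs. \<not> hit h s}"
  have fU: "finite ?U" using S by simp
  have "\<exists>h\<in>H. p * real (card ?U) \<le> real (card {s \<in> ?U. hit h s})"
  proof (rule ccontr)
    assume "\<not> ?thesis"
    \<comment> \<open>The pairs of \<open>h\<close> and a missed \<open>s\<close> hit by it are
      counted in both orders.\<close>
    then have "(\<Sum>h\<in>H. real (card {s \<in> ?U. hit h s})) < (\<Sum>h\<in>H. p * real (card ?U))"
      using H by (intro sum_strict_mono) auto
    also have "\<dots> = (\<Sum>s\<in>?U. p * real (card H))" by simp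
    also have "\<dots> \<le> (\<Sum>s\<in>?U. real (card {h \<in> H. hit h s}))"
      using hit by (intro sum_mono) auto
    also have "\<dots> = (\<Sum>s\<in>?U. \<Sum>h | h \<in> H \<and> hit h s. 1)" by simp
    also have "\<dots> = (\<Sum>h\<in>H. \<Sum>s | s \<in> ?U \<and> hit h s. 1)"
      using H(1) fU by (rule sum.swap_restrict[symmetric])
    also have "\<dots> = (\<Sum>h\<in>H. real (card {s \<in> ?U. hit h s}))" by simp
    finally show False by simp
  qed
  then obtain h where h: "h \<in> H" "p * real (card ?U) \<le> real (card {s \<in> ?U. hit h s})" by blast
  have "card ({s \<in> ?U. hit h s} \<union> {s \<in> ?U. \<not> hit h s}) = card {s \<in> ?U. hit h s} + card {s \<in> ?U. \<not> hit h s}"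
    using S by (intro card_Un_disjoint) auto
  moreover have "{s \<in> ?U. hit h s} \<union> {s \<in> ?U. \<not> hit h s} = ?U" by blast
  ultimately have "card ?U = card {s \<in> ?U. hit h s} + card {s \<in> ?U. \<not> hit h s}" by (simp only:)
  then have "real (card {s \<in> ?U. \<not> hit h s}) \<le> (1 - p) * real (card ?U)"
    using h(2) by (simp add: algebra_simps)
  also have "\<dots> \<le> (1 - p) * ((1 - p) ^ q * real (card S))"
    using hs(3) p by (intro mult_left_mono) auto
  finally have "real (card {s \<in> ?U. \<not> hit h s}) \<le> (1 - p) ^ Suc q * real (card S)" by simp
  moreover have "{s \<in> ?U. \<not> hit h s} = {s \<in> S. \<forall>h'\<in>set (h # hs). \<not> hit h' s}" by auto
  ultimately show ?case using hs h by (intro exI[of _ "h # hs"]) auto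
qed

text \<open>The quotient of \<open>l ^ l\<close> by \<open>l!\<close> is a single term of the
  exponential series at \<open>l\<close>.\<close>

lemma power_le_exp_fact: "real l ^ l \<le> exp (real l) * fact l"
proof -
  have "real l ^ l /\<^sub>R fact l \<le> suminf (\<lambda>k. real l ^ k /\<^sub>R fact k)"
    using sum_le_suminf[OF summable_exp_generic[of "real l"], of "{l}"] by simp
  then have "real l ^ l /\<^sub>R fact l \<le> exp (real l)" by (simp add: exp_def)
  then show ?thesis by (simp add: field_simps)
qed

text \<open>After \<open>q\<close> greedy choices with \<open>p = exp (- l)\<close>, the number of
  missed sets is at most \<open>exp (l * ln n - p * q)\<close>. The hypothesis on \<open>q\<close>
  makes this less than 1, so no set is missed.\<close>

lemma perfect_hash_family:
  assumes l: "0 < l" "l \<le> n" and q: "exp (real l) * real l * ln (real n) < real q"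
  shows "\<exists>phi :: nat \<Rightarrow> nat \<Rightarrow> nat. (\<forall>i<q. \<forall>v\<in>{1..n}. phi i v < l) \<and>
    (\<forall>S. S \<subseteq> {1..n} \<longrightarrow> card S = l \<longrightarrow> (\<exists>i<q. inj_on (phi i) S))"
proof -
  let ?H = "{1..n} \<rightarrow>\<^sub>E {..<l}"
  let ?S = "{S. S \<subseteq> {1..n} \<and> card S = l}"
  define p where "p = exp (- real l)"
  have cH: "card ?H = l ^ n" by (simp add: card_PiE)
  have hit: "p * real (card ?H) \<le> real (card {h \<in> ?H. inj_on h S})" if "S \<in> ?S" for S
  proof -
    have S: "S \<subseteq> {1..n}" "card S = l" using that by auto
    have fl: "(\<Prod>i = 0..<l. l - i) = fact l"
      by (simp add: fact_prod_rev)
    \<comment> \<open>An injective colouring maps \<open>S\<close> onto all \<open>l\<close> colours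
      in \<open>l!\<close> ways and is free on the other \<open>n - l\<close> vertices.\<close>
    have "card {h \<in> ?H. inj_on h S} = l ^ (n - l) * fact l"
      using card_inj_on_subset_funcset[of "{1..n}" "{..<l}" S] S fl by simp
    moreover have "p * real (l ^ n) \<le> real (l ^ (n - l)) * fact l"
    proof -
      have "p * real (l ^ n) = p * real l ^ l * real (l ^ (n - l))"
        using l by (simp add: power_add[symmetric])
      also have "\<dots> \<le> p * (exp (real l) * fact l) * real (l ^ (n - l))"
        using power_le_exp_fact[of l] by (intro mult_right_mono mult_left_mono) (auto simp: p_def)
      also have "\<dots> = real (l ^ (n - l)) * fact l"
        by (simp add: p_def exp_minus)
      finally show ?thesis .
    qed
    ultimately show ?thesis using cH by simp
  qed
  have "?H \<noteq> {}" using l by (auto simp: PiE_eq_empty_iff)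
  moreover have "finite ?H" by (intro finite_PiE) auto
  ultimately obtain hs where hs: "length hs = q" "set hs \<subseteq> ?H"
    "real (card {S \<in> ?S. \<forall>h\<in>set hs. \<not> inj_on h S}) \<le> (1 - p) ^ q * real (card ?S)"
    using greedy_cover[of ?H ?S p inj_on q] hit by (auto simp: p_def)
  have "(1 - p) ^ q * real (card ?S) < 1"
  proof -
    have n: "real n \<ge> 1" using l by simp
    have "card ?S = n choose l" by (simp add: n_subsets)
    then have S: "real (card ?S) \<le> exp (real l * ln (real n))"
      using binomial_le_pow[OF l(2)] n
      by (metis exp_of_nat_mult exp_ln of_nat_le_iff of_nat_power order_less_le_trans zero_less_one)
    have "1 - p \<le> exp (- p)" using exp_ge_add_one_self[of "-p"] by simp
    then have "(1 - p) ^ q \<le> exp (- p) ^ q" by (intro power_mono) (auto simp: p_def)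
    also have "\<dots> = exp (- (p * real q))" by (simp add: exp_of_nat_mult[symmetric] mult.commute)
    finally have "(1 - p) ^ q * real (card ?S) \<le> exp (- (p * real q)) * exp (real l * ln (real n))"
      using S by (intro mult_mono) auto
    also have "\<dots> = exp (real l * ln (real n) - p * real q)" by (simp add: exp_add[symmetric])
    also have "\<dots> < 1"
    proof -
      have "p * (exp (real l) * real l * ln (real n)) < p * real q"
        using q by (intro mult_strict_left_mono) (auto simp: p_def)
      moreover have "p * (exp (real l) * real l * ln (real n)) = real l * ln (real n)"
        by (simp add: p_def exp_minus)
      ultimately show ?thesis by simp
    qed
    finally show ?thesis .
  qed
  then have "card {S \<in> ?S. \<forall>h\<in>set hs. \<not> inj_on h S} = 0" using hs(3) by linarith
  then have none: "{S \<in> ?S. \<forall>h\<in>set hs. \<not> inj_on h S} = {}" by (subst (asm) card_0_eq) auto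
  have ex: "\<exists>i<q. inj_on (hs ! i) S" if "S \<subseteq> {1..n}" "card S = l" for S
  proof -
    have "S \<in> ?S" using that by simp
    then have "\<exists>h\<in>set hs. inj_on h S" using none by blast
    then obtain h where h: "h \<in> set hs" "inj_on h S" by blast
    from h(1) obtain i where "i < length hs" "hs ! i = h" by (auto simp: in_set_conv_nth)
    then show ?thesis using hs(1) h(2) by auto
  qed
  have lt: "(hs ! i) v < l" if "i < q" "v \<in> {1..n}" for i v
  proof -
    have "hs ! i \<in> ?H" using hs(1) that(1) by (intro subsetD[OF hs(2)] nth_mem) simp
    then show ?thesis using PiE_mem[OF _ that(2)] by blast
  qed
  show ?thesis
  proof (intro exI[of _ "\<lambda>i. hs ! i"] conjI allI ballI impI)
    show "(hs ! i) v < l" if "i < q" "v \<in> {1..n}" for i v using lt that .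
    show "\<exists>i<q. inj_on (hs ! i) S" if "S \<subseteq> {1..n}" "card S = l" for S using ex that .
  qed
qed

section \<open>Cycles as colourful closed walks\<close>

text \<open>If positions \<open>i\<close> and \<open>j\<close> gave the same edge crosswise, each
  would be the cyclic successor of the other, which is impossible for \<open>l \<ge> 3\<close>.
  Hence summing over positions counts every edge of the cycle once.\<close>

lemma cycle_edges_inj:
  assumes vs: "distinct vs" and l: "length vs = l" "3 \<le> l"
  shows "inj_on (\<lambda>i. {vs ! i, vs ! (Suc i mod l)}) {..<l}"
proof (rule inj_onI)
  fix i j assume ij: "i \<in> {..<l}" "j \<in> {..<l}"
    and eq: "{vs ! i, vs ! (Suc i mod l)} = {vs ! j, vs ! (Suc j mod l)}"
  have "Suc i mod l = (if Suc i = l then 0 else Suc i)" "Suc j mod l = (if Suc j = l then 0 else Suc j)"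
    using ij by auto
  moreover have "i = j \<or> i = Suc j mod l \<and> Suc i mod l = j"
    using eq vs ij l by (auto simp: doubleton_eq_iff nth_eq_iff_index_eq)
  ultimately show "i = j" using l(2) ij by (auto split: if_splits)
qed

lemma char_vec_cycle:
  assumes "distinct vs" "length vs = l" "3 \<le> l"
  shows "char_vec {{vs ! i, vs ! (Suc i mod l)} | i. i < l} =
    (\<Sum>i<l. Poly_Mapping.single {vs ! i, vs ! (Suc i mod l)} 1)"
proof -
  have "{{vs ! i, vs ! (Suc i mod l)} | i. i < l} = (\<lambda>i. {vs ! i, vs ! (Suc i mod l)}) ` {..<l}" by auto
  then show ?thesis
    unfolding char_vec_def using cycle_edges_inj[OF assms] by (simp add: sum.reindex)
qed

text \<open>
  A state \<open>(i, s, v, S)\<close> stands for a walk from \<open>s\<close> to \<open>v\<close> whose vertices after the first one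
  have pairwise distinct colours under \<open>\<phi> i\<close>, forming the set \<open>S\<close>. As the last step must lead
  to \<open>s\<close>, the colour of \<open>s\<close> cannot occur earlier, so a complete walk is a simple cycle.
\<close>

type_synonym state = "nat \<times> nat \<times> nat \<times> nat set"

text \<open>Colouring \<open>i\<close> and start \<open>s\<close> are constant along arcs, so this
  is a disjoint union of networks. The last two conditions fix the source at the start vertex and
  make the step that uses the last colour close the walk.\<close>

definition colour_arcs :: "(nat \<Rightarrow> nat \<Rightarrow> nat) \<Rightarrow> nat \<Rightarrow> nat \<Rightarrow> nat \<Rightarrow> (state \<times> state) set" where
  "colour_arcs \<phi> q n l = {((i, s, v, S), (i, s, w, insert (\<phi> i w) S)) | i s v S w.
     i < q \<and> s \<in> {1..n} \<and> v \<in> {1..n} \<and> w \<in> {1..n} \<and> v \<noteq> w \<and> S \<subseteq> {..<l} \<and>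
     \<phi> i w < l \<and> \<phi> i w \<notin> S \<and> (S = {} \<longrightarrow> v = s) \<and> (Suc (card S) = l \<longrightarrow> w = s)}"

definition state_rank :: "state \<Rightarrow> nat" where
  "state_rank = (\<lambda>(i, s, v, S). card S)"

definition arc_edge :: "state \<times> state \<Rightarrow> nat set" where
  "arc_edge = (\<lambda>((i, s, v, S), (j, t, w, U)). {v, w})"

text \<open>These sets are the \<open>R\<close> of \<open>layered_flow_cost\<close>. Colours are
  collected over \<open>{1..k}\<close>, so the start vertex contributes its colour only when it is
  reached again.\<close>

definition walk_costs :: "(nat \<Rightarrow> nat \<Rightarrow> nat) \<Rightarrow> nat \<Rightarrow> state \<Rightarrow> (nat set \<Rightarrow>\<^sub>0 real) set" where
  "walk_costs \<phi> n = (\<lambda>(i, s, v, S). {(\<Sum>j<k. Poly_Mapping.single {x j, x (Suc j)} 1) | k x.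
     x 0 = s \<and> x k = v \<and> x ` {..k} \<subseteq> {1..n} \<and> inj_on (\<phi> i \<circ> x) {1..k} \<and>
     S = (\<phi> i \<circ> x) ` {1..k}})"

text \<open>An arc is determined by \<open>i\<close>, \<open>s\<close>, \<open>v\<close>,
  \<open>S\<close> and \<open>w\<close>; the three vertices give the factor
  \<open>n ^ 3\<close>.\<close>

lemma colour_arcs_card:
  "finite (colour_arcs \<phi> q n l) \<and> card (colour_arcs \<phi> q n l) \<le> q * 2 ^ l * n ^ 3"
proof -
  let ?D = "{..<q} \<times> {1..n} \<times> {1..n} \<times> Pow {..<l} \<times> {1..n}"
  let ?f = "\<lambda>(i, s, v, S, w). ((i, s, v, S), (i, s, w, insert (\<phi> i w) S))"
  have sub: "colour_arcs \<phi> q n l \<subseteq> ?f ` ?D"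
  proof
    fix e assume "e \<in> colour_arcs \<phi> q n l"
    then obtain i s v S w where e: "e = ((i, s, v, S), (i, s, w, insert (\<phi> i w) S))"
      "i < q" "s \<in> {1..n}" "v \<in> {1..n}" "w \<in> {1..n}" "S \<subseteq> {..<l}"
      unfolding colour_arcs_def by blast
    then show "e \<in> ?f ` ?D" by (intro image_eqI[of _ _ "(i, s, v, S, w)"]) auto
  qed
  have fD: "finite ?D" by simp
  have "card (colour_arcs \<phi> q n l) \<le> card (?f ` ?D)" using sub fD by (intro card_mono) auto
  also have "\<dots> \<le> card ?D" using fD by (rule card_image_le)
  also have "\<dots> = q * 2 ^ l * n ^ 3"
    by (simp add: card_cartesian_product card_Pow power3_eq_cube)
  finally show ?thesis using finite_subset[OF sub] fD by blast
qed

text \<open>Each step adds one colour outside \<open>S\<close>, so \<open>S\<close> misses one of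
  the \<open>l\<close> colours and the number of colours counts the steps.\<close>

lemma colour_arcs_rank:
  assumes "(a, b) \<in> colour_arcs \<phi> q n l"
  shows "state_rank b = Suc (state_rank a) \<and> state_rank a < l"
proof -
  obtain i s v S w where e: "a = (i, s, v, S)" "b = (i, s, w, insert (\<phi> i w) S)"
    "S \<subseteq> {..<l}" "\<phi> i w < l" "\<phi> i w \<notin> S"
    using assms unfolding colour_arcs_def by blast
  have f: "finite S" using e(3) finite_subset by blast
  have "card S < card {..<l}" using e(3-5) by (intro psubset_card_mono) auto
  then show ?thesis using e f by (simp add: state_rank_def)
qed

lemma arc_edge_mem:
  assumes "e \<in> colour_arcs \<phi> q n l"
  shows "arc_edge e \<in> complete_edges n"
proof -
  obtain i s v S w where "e = ((i, s, v, S), (i, s, w, insert (\<phi> i w) S))"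
    "v \<in> {1..n}" "w \<in> {1..n}" "v \<noteq> w"
    using assms unfolding colour_arcs_def by blast
  then show ?thesis by (simp add: arc_edge_def complete_edges_def)
qed

lemma walk_costs_start:
  assumes "(a, b) \<in> colour_arcs \<phi> q n l" "state_rank a = 0"
  shows "0 \<in> walk_costs \<phi> n a"
proof -
  obtain i s v S where a: "a = (i, s, v, S)" "s \<in> {1..n}" "S \<subseteq> {..<l}" "S = {} \<longrightarrow> v = s"
    using assms(1) unfolding colour_arcs_def by blast
  have "S = {}" using assms(2) a(1,3) finite_subset[OF a(3)] by (simp add: state_rank_def)
  then have "a = (i, s, s, {})" using a by simp
  then show ?thesis using a(2) unfolding walk_costs_def
    by (auto intro!: exI[of _ 0] exI[of _ "\<lambda>_. s"])
qed

lemma walk_costs_step: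
  assumes "(a, b) \<in> colour_arcs \<phi> q n l" "z \<in> walk_costs \<phi> n a"
  shows "z + Poly_Mapping.single (arc_edge (a, b)) 1 \<in> walk_costs \<phi> n b"
proof -
  obtain i s v S w where e: "a = (i, s, v, S)" "b = (i, s, w, insert (\<phi> i w) S)"
    "w \<in> {1..n}" "\<phi> i w \<notin> S"
    using assms unfolding colour_arcs_def by blast
  obtain k x where x: "z = (\<Sum>j<k. Poly_Mapping.single {x j, x (Suc j)} 1)"
     "x 0 = s" "x k = v" "x ` {..k} \<subseteq> {1..n}" "inj_on (\<phi> i \<circ> x) {1..k}" "S = (\<phi> i \<circ> x) ` {1..k}"
    using assms(2) unfolding e walk_costs_def by auto
  let ?x = "x(Suc k := w)"
  have im: "(\<phi> i \<circ> ?x) ` {1..k} = (\<phi> i \<circ> x) ` {1..k}" by (intro image_cong) auto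
  have iv: "{1..Suc k} = insert (Suc k) {1..k}" by auto
  have "z + Poly_Mapping.single (arc_edge (a, b)) 1 = (\<Sum>j<Suc k. Poly_Mapping.single {?x j, ?x (Suc j)} 1)"
    using x(1,3) by (simp add: e arc_edge_def)
  moreover have "?x 0 = s" "?x (Suc k) = w" using x(2) by auto
  moreover have "?x ` {..Suc k} \<subseteq> {1..n}" using x(4) e(3) by auto
  moreover have "inj_on (\<phi> i \<circ> ?x) {1..Suc k}"
  proof -
    have "inj_on (\<phi> i \<circ> ?x) {1..k}" using x(5) by (subst inj_on_cong[of _ _ "\<phi> i \<circ> x"]) auto
    moreover have "(\<phi> i \<circ> ?x) (Suc k) \<notin> (\<phi> i \<circ> ?x) ` {1..k}"
      unfolding im x(6)[symmetric] using e(4) by simp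
    ultimately show ?thesis unfolding iv by simp
  qed
  moreover have "insert (\<phi> i w) S = (\<phi> i \<circ> ?x) ` {1..Suc k}"
    unfolding iv image_insert im x(6) by simp
  ultimately show ?thesis unfolding e(2) walk_costs_def by blast
qed

text \<open>Rank \<open>l\<close> means that the last arc used the last colour, so the walk is back
  at \<open>s\<close>. Its \<open>l\<close> steps reach vertices of distinct colours, hence distinct
  vertices.\<close>

lemma walk_costs_final:
  assumes "b \<in> snd ` colour_arcs \<phi> q n l" "state_rank b = l" "3 \<le> l"
  shows "walk_costs \<phi> n b \<subseteq> char_vec ` simple_cycles n l"
proof
  fix z assume z: "z \<in> walk_costs \<phi> n b"
  obtain a where "(a, b) \<in> colour_arcs \<phi> q n l" using assms(1) by auto
  then obtain i s S w where e: "b = (i, s, w, insert (\<phi> i w) S)" "S \<subseteq> {..<l}"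
     "\<phi> i w \<notin> S" "Suc (card S) = l \<longrightarrow> w = s"
    unfolding colour_arcs_def by blast
  have "finite S" using e(2) finite_subset by blast
  then have b: "b = (i, s, s, insert (\<phi> i s) S)" "card (insert (\<phi> i s) S) = l"
    using e assms(2) by (auto simp: state_rank_def)
  obtain k x where x: "z = (\<Sum>j<k. Poly_Mapping.single {x j, x (Suc j)} 1)"
     "x 0 = s" "x k = s" "x ` {..k} \<subseteq> {1..n}" "inj_on (\<phi> i \<circ> x) {1..k}"
     "insert (\<phi> i s) S = (\<phi> i \<circ> x) ` {1..k}"
    using z unfolding b(1) walk_costs_def by auto
  have k: "k = l" using b(2) card_image[OF x(5)] x(6) by simp
  define vs where "vs = map x [0..<l]"
  have "inj_on x {1..k}" using x(5) by (rule inj_on_imageI2)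
  have "inj_on x {0..<l}"
  proof (rule inj_onI)
    fix a c assume ac: "a \<in> {0..<l}" "c \<in> {0..<l}" "x a = x c"
    \<comment> \<open>Positions 0 and \<open>l\<close> hold the same vertex; replacing 0 by
      \<open>l\<close> moves \<open>{0..<l}\<close> into the range on which \<open>x\<close> is
      known to be injective.\<close>
    define up where "up a = (if a = 0 then l else a)" for a
    have "up a \<in> {1..k}" "up c \<in> {1..k}" "x (up a) = x (up c)"
      using ac x(2,3) assms(3) by (auto simp: up_def k)
    then have "up a = up c" using \<open>inj_on x {1..k}\<close> by (meson inj_onD)
    then show "a = c" using ac by (auto simp: up_def split: if_splits)
  qed
  then have vs: "distinct vs" "length vs = l" by (auto simp: vs_def distinct_map)
  have "set vs \<subseteq> {1..n}" using x(4) k by (auto simp: vs_def)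
  then have C: "{{vs ! j, vs ! (Suc j mod l)} | j. j < l} \<in> simple_cycles n l"
    using vs assms(3) unfolding simple_cycles_def by blast
  have "{vs ! j, vs ! (Suc j mod l)} = {x j, x (Suc j)}" if "j < l" for j
  proof (cases "Suc j = l")
    case True
    then show ?thesis using that x(2,3) k by (simp add: vs_def)
  next
    case False
    then show ?thesis using that by (simp add: vs_def)
  qed
  then have "z = char_vec {{vs ! j, vs ! (Suc j mod l)} | j. j < l}"
    unfolding char_vec_cycle[OF vs assms(3)] x(1) k by (intro sum.cong) auto
  then show "z \<in> char_vec ` simple_cycles n l" using C by blast
qed

section \<open>Cycles as flows, and the image of the flow polyhedron\<close>

text \<open>The indicator of the arcs of a source-sink path is a unit flow. The \<open>k\<close>-th
  node having rank \<open>k\<close> makes the arcs distinct, so sums over arcs become sums over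
  positions.\<close>

lemma path_flow:
  fixes x :: "nat \<Rightarrow> 'v" and E :: "('v \<times> 'v) set" and f :: "'v \<times> 'v \<Rightarrow> 'b::real_vector"
  assumes E: "finite E" and rank: "\<And>k. k \<le> L \<Longrightarrow> r (x k) = k"
    and arcs: "\<And>k. k < L \<Longrightarrow> (x k, x (Suc k)) \<in> E" and L: "0 < L"
  defines "y \<equiv> \<lambda>e. of_bool (e \<in> (\<lambda>k. (x k, x (Suc k))) ` {..<L}) :: real"
  shows "unit_flow E r L y"
    and "(\<Sum>e\<in>E. y e *\<^sub>R f e) = (\<Sum>k<L. f (x k, x (Suc k)))"
proof -
  let ?e = "\<lambda>k. (x k, x (Suc k))"
  have inj: "inj_on ?e {..<L}"
    using rank by (intro inj_onI) (metis lessThan_iff less_imp_le prod.inject)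
  have sums: "(\<Sum>e\<in>E. y e *\<^sub>R g e) = (\<Sum>k<L. g (?e k))" for g :: "_ \<Rightarrow> 'c::real_vector"
  proof -
    have "(\<Sum>e\<in>E. y e *\<^sub>R g e) = (\<Sum>e\<in>?e ` {..<L}. g e)"
      using E arcs by (intro sum.mono_neutral_cong_right) (auto simp: y_def)
    also have "\<dots> = (\<Sum>k<L. g (?e k))" using inj by (simp add: sum.reindex)
    finally show ?thesis .
  qed
  show "(\<Sum>e\<in>E. y e *\<^sub>R f e) = (\<Sum>k<L. f (x k, x (Suc k)))" by (rule sums)
  have part: "(\<Sum>e | e \<in> E \<and> P e. y e) = (\<Sum>k<L. of_bool (P (?e k)))" for P
  proof -
    have "(\<Sum>e | e \<in> E \<and> P e. y e) = (\<Sum>e\<in>E. y e *\<^sub>R of_bool (P e))"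
      using E by (intro sum.mono_neutral_cong_left) auto
    also have "\<dots> = (\<Sum>k<L. of_bool (P (?e k)))" by (rule sums)
    finally show ?thesis .
  qed
  show "unit_flow E r L y"
    unfolding unit_flow_def
  proof (intro conjI allI impI ballI)
    show "0 \<le> y e" for e by (simp add: y_def)
    fix v assume v: "0 < r v \<and> r v < L"
    then obtain m where m: "r v = Suc m" by (cases "r v") auto
    \<comment> \<open>A node of rank \<open>Suc m\<close> can only be entered by arc
      \<open>m\<close> and left by arc \<open>Suc m\<close>; both positions are below
      \<open>L\<close>, and both sums ask whether \<open>v\<close> is the path node
      \<open>x (Suc m)\<close>.\<close>
    have "(\<Sum>k<L. of_bool (snd (?e k) = v)) = (\<Sum>k<L. if k = m then of_bool (x (Suc m) = v) else (0::real))"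
      using rank m by (intro sum.cong) auto
    moreover have "(\<Sum>k<L. of_bool (fst (?e k) = v)) = (\<Sum>k<L. if k = Suc m then of_bool (x (Suc m) = v) else (0::real))"
      using rank m by (intro sum.cong) auto
    ultimately show "(\<Sum>e | e \<in> E \<and> snd e = v. y e) = (\<Sum>e | e \<in> E \<and> fst e = v. y e)"
      unfolding part using v m by simp
  next
    have "(\<Sum>k<L. of_bool (r (fst (?e k)) = 0)) = (\<Sum>k<L. if k = 0 then 1 else (0::real))"
      using rank by (intro sum.cong) auto
    then show "(\<Sum>e | e \<in> E \<and> r (fst e) = 0. y e) = 1"
      unfolding part using L by simp
  qed
qed

text \<open>The hash family supplies a colouring injective on the vertices of the cycle. Under it,
  going once around the cycle from \<open>vs ! 0\<close> is a source-sink path, whose indicator flow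
  maps to the characteristic vector.\<close>

lemma cycle_flow:
  assumes hash: "\<And>S. S \<subseteq> {1..n} \<Longrightarrow> card S = l \<Longrightarrow> \<exists>i<q. inj_on (\<phi> i) S"
    and col: "\<And>i v. i < q \<Longrightarrow> v \<in> {1..n} \<Longrightarrow> \<phi> i v < l"
    and C: "C \<in> simple_cycles n l"
  shows "\<exists>y. unit_flow (colour_arcs \<phi> q n l) state_rank l y \<and>
    (\<Sum>e\<in>colour_arcs \<phi> q n l. y e *\<^sub>R Poly_Mapping.single (arc_edge e) 1) = char_vec C"
proof -
  obtain vs where vs: "distinct vs" "length vs = l" "set vs \<subseteq> {1..n}" "3 \<le> l"
    "C = {{vs ! i, vs ! (Suc i mod l)} | i. i < l}"
    using C unfolding simple_cycles_def by blast
  have "card (set vs) = l" using vs by (simp add: distinct_card)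
  then obtain i where i: "i < q" "inj_on (\<phi> i) (set vs)" using hash vs(3) by blast
  \<comment> \<open>Periodic indexing gives \<open>u l = u 0\<close>: positions
    \<open>{1..l}\<close> list the vertices once, with the start last, as the states record
    them.\<close>
  define u where "u k = vs ! (k mod l)" for k
  have u_in: "u k \<in> set vs" for k using vs(2,4) by (simp add: u_def)
  have u_inj: "inj_on u {1..l}"
  proof (rule inj_onI)
    fix a c assume ac: "a \<in> {1..l}" "c \<in> {1..l}" "u a = u c"
    then have "a mod l = c mod l" using vs(1,2,4) by (simp add: u_def nth_eq_iff_index_eq)
    then show "a = c" using ac by (cases "a = l"; cases "c = l") auto
  qed
  define x where "x k = (i, u 0, u k, (\<phi> i \<circ> u) ` {1..k})" for k
  have cinj: "inj_on (\<phi> i \<circ> u) {1..l}"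
    using u_inj i(2) u_in by (intro comp_inj_on) (auto intro: inj_on_subset)
  have rank: "state_rank (x k) = k" if "k \<le> l" for k
  proof -
    have "inj_on (\<phi> i \<circ> u) {1..k}" using cinj that by (auto intro: inj_on_subset)
    then have "card ((\<phi> i \<circ> u) ` {1..k}) = k" by (simp only: card_image card_atLeastAtMost diff_Suc_1)
    then show ?thesis unfolding x_def state_rank_def by simp
  qed
  have arcs: "(x k, x (Suc k)) \<in> colour_arcs \<phi> q n l" if k: "k < l" for k
  proof -
    let ?S = "(\<phi> i \<circ> u) ` {1..k}"
    have iv: "{1..Suc k} = insert (Suc k) {1..k}" by auto
    have xs: "x (Suc k) = (i, u 0, u (Suc k), insert (\<phi> i (u (Suc k))) ?S)"
      unfolding x_def iv by simp
    have un: "u j \<in> {1..n}" for j using u_in vs(3) by blast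
    have "u k \<noteq> u (Suc k)"
    proof -
      have "k \<noteq> Suc k mod l" using k vs(4) by (cases "Suc k = l") auto
      then show ?thesis using vs(1,2) k by (simp add: u_def nth_eq_iff_index_eq)
    qed
    moreover have "\<phi> i (u (Suc k)) \<notin> ?S"
    proof
      assume "\<phi> i (u (Suc k)) \<in> ?S"
      then obtain j where j: "j \<in> {1..k}" "(\<phi> i \<circ> u) (Suc k) = (\<phi> i \<circ> u) j" by auto
      then have "Suc k = j" using k by (intro inj_onD[OF cinj j(2)]) simp_all
      then show False using j(1) by simp
    qed
    moreover have "?S = {} \<longrightarrow> u k = u 0" by (cases k) auto
    moreover have "Suc (card ?S) = l \<longrightarrow> u (Suc k) = u 0"
      using rank[of k] k by (auto simp: x_def state_rank_def u_def)
    moreover have "?S \<subseteq> {..<l}" using un col[OF i(1)] by auto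
    ultimately show ?thesis
      unfolding xs unfolding x_def colour_arcs_def mem_Collect_eq using i(1) un col[OF i(1) un]
      by (intro exI[of _ i] exI[of _ "u 0"] exI[of _ "u k"] exI[of _ ?S] exI[of _ "u (Suc k)"] conjI refl)
  qed
  have fin: "finite (colour_arcs \<phi> q n l)" using colour_arcs_card by blast
  have l: "0 < l" using vs(4) by simp
  have cost: "(\<Sum>k<l. Poly_Mapping.single (arc_edge (x k, x (Suc k))) 1) = char_vec C"
    unfolding vs(5) char_vec_cycle[OF vs(1,2,4)]
    by (intro sum.cong) (auto simp: x_def arc_edge_def u_def)
  let ?y = "\<lambda>e. of_bool (e \<in> (\<lambda>k. (x k, x (Suc k))) ` {..<l}) :: real"
  have "unit_flow (colour_arcs \<phi> q n l) state_rank l ?y"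
    by (rule path_flow(1)[OF fin rank arcs l])
  moreover have "(\<Sum>e\<in>colour_arcs \<phi> q n l. ?y e *\<^sub>R Poly_Mapping.single (arc_edge e) 1) = char_vec C"
    by (rule trans[OF path_flow(2)[OF fin rank arcs l] cost])
  ultimately show ?thesis by (intro exI[of _ ?y] conjI)
qed

text \<open>Flow decomposition puts the image inside the hull of complete walks, which are cycles.
  Conversely the image is convex and contains the vector of every cycle by
  \<open>cycle_flow\<close>.\<close>

lemma flow_image_eq_cycle_polytope:
  assumes l: "3 \<le> l"
    and hash: "\<And>S. S \<subseteq> {1..n} \<Longrightarrow> card S = l \<Longrightarrow> \<exists>i<q. inj_on (\<phi> i) S"
    and col: "\<And>i v. i < q \<Longrightarrow> v \<in> {1..n} \<Longrightarrow> \<phi> i v < l"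
  defines "E \<equiv> colour_arcs \<phi> q n l"
  shows "(\<lambda>y. \<Sum>e\<in>E. y e *\<^sub>R Poly_Mapping.single (arc_edge e) 1) ` {y. unit_flow E state_rank l y}
    = cycle_polytope n l" (is "?f ` ?Y = _")
proof
  have fin: "finite E" unfolding E_def using colour_arcs_card by blast
  show "?f ` ?Y \<subseteq> cycle_polytope n l"
  proof
    fix z assume "z \<in> ?f ` ?Y"
    then obtain y where y: "unit_flow E state_rank l y" "z = ?f y" by auto
    have "?f y \<in> convex hull (\<Union>v\<in>{v \<in> snd ` E. state_rank v = l}. walk_costs \<phi> n v)"
    proof (rule layered_flow_cost[OF fin])
      show "state_rank b = Suc (state_rank a) \<and> state_rank a < l" if "(a, b) \<in> E" for a b
        using that unfolding E_def by (rule colour_arcs_rank)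
      show "0 \<in> walk_costs \<phi> n a" if "(a, b) \<in> E" "state_rank a = 0" for a b
        using that unfolding E_def by (rule walk_costs_start)
      show "z + Poly_Mapping.single (arc_edge (a, b)) 1 \<in> walk_costs \<phi> n b"
        if "(a, b) \<in> E" "z \<in> walk_costs \<phi> n a" for a b z
        using that unfolding E_def by (rule walk_costs_step)
    qed (use y(1) in \<open>auto simp: unit_flow_def\<close>)
    also have "\<dots> \<subseteq> cycle_polytope n l"
      unfolding cycle_polytope_def
    proof (rule hull_mono, rule UN_least)
      fix v assume "v \<in> {v \<in> snd ` E. state_rank v = l}"
      then show "walk_costs \<phi> n v \<subseteq> char_vec ` simple_cycles n l"
        using walk_costs_final l unfolding E_def by blast
    qed
    finally show "z \<in> cycle_polytope n l" using y(2) by simp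
  qed
  show "cycle_polytope n l \<subseteq> ?f ` ?Y"
    unfolding cycle_polytope_def
  proof (rule hull_minimal)
    show "char_vec ` simple_cycles n l \<subseteq> ?f ` ?Y"
    proof
      fix z assume "z \<in> char_vec ` simple_cycles n l"
      then obtain C where "C \<in> simple_cycles n l" "z = char_vec C" by blast
      then obtain y where "unit_flow E state_rank l y" "?f y = z"
        using cycle_flow[of n l q \<phi> C] hash col unfolding E_def by blast
      then show "z \<in> ?f ` ?Y" by blast
    qed
    show "convex (?f ` ?Y)"
    proof (rule convexI)
      fix a b :: "nat set \<Rightarrow>\<^sub>0 real" and s t :: real
      assume "a \<in> ?f ` ?Y" "b \<in> ?f ` ?Y" and st: "0 \<le> s" "0 \<le> t" "s + t = 1"
      then obtain y y' where y: "unit_flow E state_rank l y" "a = ?f y"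
        and y': "unit_flow E state_rank l y'" "b = ?f y'" by auto
      let ?y = "\<lambda>e. s * y e + t * y' e"
      have sums: "(\<Sum>e\<in>A. ?y e) = s * (\<Sum>e\<in>A. y e) + t * (\<Sum>e\<in>A. y' e)" for A
        by (simp add: sum.distrib sum_distrib_left)
      have "unit_flow E state_rank l ?y"
        using y(1) y'(1) st unfolding unit_flow_def sums by simp
      moreover have "s *\<^sub>R a + t *\<^sub>R b = ?f ?y"
        unfolding y(2) y'(2) by (simp add: scaleR_sum_right sum.distrib[symmetric] scaleR_add_left)
      ultimately show "s *\<^sub>R a + t *\<^sub>R b \<in> ?f ` ?Y" by (intro image_eqI[of _ _ ?y]) auto
    qed
  qed
qed

section \<open>Encoding lengths, size estimate and conclusion\<close>

lemma encoding_length_unit: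
  assumes "a \<in> {0, 1, -1}"
  shows "encoding_length a \<le> 5"
  \<comment> \<open>The actual lengths are 2 and 3; the bound 5 is the constant shared with the
    exponent in \<open>hash_family_size\<close>.\<close>
  using assms by (auto simp: encoding_length_def rat_uminus_code)

lemma facets_empty: "facets {} = {}"
  by (auto simp: facets_def face_of_def)

lemma simple_cycles_empty:
  assumes "l < 3 \<or> n < l"
  shows "simple_cycles n l = {}"
proof -
  have "length vs \<le> n" if "distinct vs" "set vs \<subseteq> {1..n}" for vs :: "nat list"
    using card_mono[OF _ that(2)] that(1) by (simp add: distinct_card)
  then show ?thesis using assms by (fastforce simp: simple_cycles_def)
qed

text \<open>Rounding costs a factor \<open>2 \<le> 2 ^ l\<close>, \<open>exp l\<close> is at most
  \<open>4 ^ l\<close>, \<open>l\<close> is at most \<open>2 ^ l\<close>, and the colour sets give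
  \<open>2 ^ l\<close>: altogether \<open>32 ^ l\<close>, hence the exponent
  \<open>5 * l\<close>.\<close>

lemma hash_family_size:
  assumes "3 \<le> l" "l \<le> n"
  obtains q where "exp (real l) * real l * ln (real n) < real q"
    "real (q * 2 ^ l * n ^ 3) \<le> 2 powr (5 * real l) * real n ^ 3 * ln (real n)"
proof -
  define X where "X = exp (real l) * real l * ln (real n)"
  \<comment> \<open>Floor plus one gives the strict bound \<open>X < q\<close>;
    \<open>q \<le> 2 * X\<close> needs \<open>X \<ge> 1\<close>, which holds because
    \<open>ln n \<ge> 1\<close> for \<open>n \<ge> 3\<close>.\<close>
  define q where "q = nat \<lfloor>X\<rfloor> + 1"
  have "1 \<le> ln (3::real)" using exp_le by (subst ln_ge_iff) auto
  also have "\<dots> \<le> ln (real n)" using assms by simp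
  finally have ln: "1 \<le> ln (real n)" .
  have "1 * 1 * 1 \<le> X"
    unfolding X_def using ln assms by (intro mult_mono) auto
  then have X: "1 \<le> X" by simp
  have q: "X < real q" "real q \<le> 2 * X" using X by (auto simp: q_def) linarith+
  have "exp (real l) = exp 1 ^ l" by (simp add: exp_of_nat_mult[symmetric])
  also have "\<dots> \<le> 4 ^ l" using exp_le by (intro power_mono) auto
  finally have e: "exp (real l) \<le> 4 ^ l" .
  have "real l \<le> 2 ^ l" using of_nat_less_two_power[of l, where 'a = real] by simp
  then have "X \<le> 4 ^ l * 2 ^ l * ln (real n)"
    unfolding X_def using e ln by (intro mult_mono) auto
  moreover have "(2::real) ^ 1 \<le> 2 ^ l" using assms by (intro power_increasing) auto
  ultimately have "2 * X \<le> 2 ^ l * (4 ^ l * 2 ^ l * ln (real n))"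
    using X by (intro mult_mono) auto
  then have "real q * 2 ^ l * real n ^ 3 \<le> (2 ^ l * (4 ^ l * 2 ^ l * ln (real n))) * 2 ^ l * real n ^ 3"
    using q by (intro mult_right_mono) auto
  also have "\<dots> = (2 * 4 * 2 * 2) ^ l * real n ^ 3 * ln (real n)"
    by (simp only: power_mult_distrib mult_ac)
  also have "(2 * 4 * 2 * 2 :: real) ^ l = 2 powr (5 * real l)"
    by (simp add: powr_powr[symmetric] powr_realpow)
  finally show ?thesis using that[of q] q(1) by (simp add: X_def)
qed

theorem theorem28:
  shows "\<exists>C::real. C > 0 \<and>
    (\<forall>n l :: nat. n > 0 \<longrightarrow> l > 0 \<longrightarrow>
      (\<exists>(d::nat) (m::nat) (A :: nat \<Rightarrow> nat \<Rightarrow> rat) (b :: nat \<Rightarrow> rat)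
        (k::nat) (B :: nat \<Rightarrow> nat \<Rightarrow> rat) (c :: nat \<Rightarrow> rat)
        (T :: nat set \<Rightarrow> nat \<Rightarrow> rat) (t :: nat set \<Rightarrow> rat).
         rat_affine_map (complete_edges n) d T t ` rat_polyhedron d m A b k B c
           = cycle_polytope n l \<and>
         finite (facets (rat_polyhedron d m A b k B c)) \<and>
         real (card (facets (rat_polyhedron d m A b k B c)))
           \<le> 2 powr (C * real l) * real n ^ 3 * ln (real n) \<and>
         (\<forall>i<m. real_of_int (encoding_length (b i)) \<le> C \<and>
            (\<forall>j<d. real_of_int (encoding_length (A i j)) \<le> C)) \<and>
         (\<forall>i<k. real_of_int (encoding_length (c i)) \<le> C \<and>
            (\<forall>j<d. real_of_int (encoding_length (B i j)) \<le> C)) \<and>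
         (\<forall>e\<in>complete_edges n. real_of_int (encoding_length (t e)) \<le> C \<and>
            (\<forall>j<d. real_of_int (encoding_length (T e j)) \<le> C))))"
proof (rule exI[of _ 5], intro conjI allI impI)
  fix n l :: nat
  assume n: "n > 0" and "l > 0"
  show "\<exists>(d::nat) (m::nat) (A :: nat \<Rightarrow> nat \<Rightarrow> rat) (b :: nat \<Rightarrow> rat)
        (k::nat) (B :: nat \<Rightarrow> nat \<Rightarrow> rat) (c :: nat \<Rightarrow> rat)
        (T :: nat set \<Rightarrow> nat \<Rightarrow> rat) (t :: nat set \<Rightarrow> rat).
         rat_affine_map (complete_edges n) d T t ` rat_polyhedron d m A b k B c
           = cycle_polytope n l \<and>
         finite (facets (rat_polyhedron d m A b k B c)) \<and>
         real (card (facets (rat_polyhedron d m A b k B c)))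
           \<le> 2 powr (5 * real l) * real n ^ 3 * ln (real n) \<and>
         (\<forall>i<m. real_of_int (encoding_length (b i)) \<le> 5 \<and>
            (\<forall>j<d. real_of_int (encoding_length (A i j)) \<le> 5)) \<and>
         (\<forall>i<k. real_of_int (encoding_length (c i)) \<le> 5 \<and>
            (\<forall>j<d. real_of_int (encoding_length (B i j)) \<le> 5)) \<and>
         (\<forall>e\<in>complete_edges n. real_of_int (encoding_length (t e)) \<le> 5 \<and>
            (\<forall>j<d. real_of_int (encoding_length (T e j)) \<le> 5))" (is ?thesis)
  proof (cases "3 \<le> l \<and> l \<le> n")
    case True
    then have l: "3 \<le> l" "l \<le> n" by auto
    obtain q where q: "exp (real l) * real l * ln (real n) < real q"
      "real (q * 2 ^ l * n ^ 3) \<le> 2 powr (5 * real l) * real n ^ 3 * ln (real n)"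
      using hash_family_size[OF l] .
    obtain \<phi> :: "nat \<Rightarrow> nat \<Rightarrow> nat" where col: "\<And>i v. i < q \<Longrightarrow> v \<in> {1..n} \<Longrightarrow> \<phi> i v < l"
      and hash: "\<And>S. S \<subseteq> {1..n} \<Longrightarrow> card S = l \<Longrightarrow> \<exists>i<q. inj_on (\<phi> i) S"
      using perfect_hash_family[OF \<open>l > 0\<close> l(2) q(1)] by metis
    let ?E = "colour_arcs \<phi> q n l"
    have fin: "finite ?E" and card: "card ?E \<le> q * 2 ^ l * n ^ 3"
      using colour_arcs_card[of \<phi> q n l] by auto
    have W: "finite (complete_edges n)"
      by (rule finite_subset[of _ "Pow {1..n}"]) (auto simp: complete_edges_def)
    have lab: "arc_edge ` ?E \<subseteq> complete_edges n" using arc_edge_mem by blast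
    have image: "(\<lambda>y. \<Sum>e\<in>?E. y e *\<^sub>R Poly_Mapping.single (arc_edge e) 1) ` {y. unit_flow ?E state_rank l y}
        = cycle_polytope n l"
      by (rule flow_image_eq_cycle_polytope[OF l(1)]) (erule (1) hash col)+
    obtain d m A b k B c T t where P:
      "rat_affine_map (complete_edges n) d T t ` rat_polyhedron d m A b k B c = cycle_polytope n l"
      "finite (facets (rat_polyhedron d m A b k B c))"
      "card (facets (rat_polyhedron d m A b k B c)) \<le> card ?E"
      and coeffs: "\<And>i j. A i j \<in> {0, 1, -1}" "\<And>i. b i \<in> {0, 1, -1}"
        "\<And>i j. B i j \<in> {0, 1, -1}" "\<And>i. c i \<in> {0, 1, -1}"
        "\<And>e j. T e j \<in> {0, 1, -1}" "\<And>e. t e \<in> {0, 1, -1}"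
      apply (rule flow_polyhedron[OF fin W lab, of state_rank l, unfolded image])
      subgoal premises prems for d m A b k B c T t by (rule prems(1)[OF prems(2-10)])
      done
    have "real (card (facets (rat_polyhedron d m A b k B c))) \<le> real (q * 2 ^ l * n ^ 3)"
      using P(3) card by (intro of_nat_mono) simp
    then have "real (card (facets (rat_polyhedron d m A b k B c)))
        \<le> 2 powr (5 * real l) * real n ^ 3 * ln (real n)"
      using q(2) by (rule order_trans)
    moreover have "real_of_int (encoding_length a) \<le> 5" if "a \<in> {0, 1, -1}" for a
      using encoding_length_unit[OF that] by simp
    note this[OF coeffs(1)] this[OF coeffs(2)] this[OF coeffs(3)] this[OF coeffs(4)]
      this[OF coeffs(5)] this[OF coeffs(6)]
    ultimately show ?thesis using P(1,2)
      by (intro exI conjI allI impI ballI) assumption+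
  next
    case False
    \<comment> \<open>There are no cycles, and the infeasible inequality \<open>0 \<le> -1\<close>
      in dimension 0 describes the empty polyhedron. It has no facets, which matters for
      \<open>n = 1\<close>, where the size bound is \<open>ln 1 = 0\<close>.\<close>
    have "rat_polyhedron 0 1 (\<lambda>_ _. 0) (\<lambda>_. -1) 0 (\<lambda>_ _. 0) (\<lambda>_. 0) = {}"
      by (auto simp: rat_polyhedron_def linear_form_def)
    moreover have "cycle_polytope n l = {}"
      using simple_cycles_empty[of l n] False by (auto simp: cycle_polytope_def)
    moreover have "0 \<le> ln (real n)" using n by simp
    ultimately show ?thesis
      by - (rule exI[of _ 0], rule exI[of _ 1], rule exI[of _ "\<lambda>_ _. 0"], rule exI[of _ "\<lambda>_. -1"],
          rule exI[of _ 0], rule exI[of _ "\<lambda>_ _. 0"], rule exI[of _ "\<lambda>_. 0"],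
          rule exI[of _ "\<lambda>_ _. 0"], rule exI[of _ "\<lambda>_. 0"],
          simp add: facets_empty encoding_length_unit)
  qed
qed simp

end
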